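(* Let $T : \mathcal{A} \to \mathcal{B}$ be a surjective linear isometry between (complex, possibly nonunital) C*-algebras, and let $M(\mathcal{B})$ be the multiplier algebra of $\mathcal{B}$. Then there are a surjective Jordan *-isomorphism $J$ from $\mathcal{A}$ to $\mathcal{B}$ and a unitary $u \in M(\mathcal{B})$ such that $$T(x) = uJ(x), \qquad \forall x \in \mathcal{A}.$$
   Context: A linear map between operator algebras is called Jordan when it preserves the Jordan product $(x,y) \mapsto \frac{1}{2}(xy+yx)$. A surjective Jordan *-isomorphism is a bijective linear Jordan map that also preserves adjoints. The multiplier algebra $M(\mathcal{B})$ is the largest C*-algebra in which $\mathcal{B}$ embeds as an essential ideal; equivalently, $M(\mathcal{B})$ is the idealizer $\{x \in \mathcal{B}^{**} \mid x\mathcal{B} \subset \mathcal{B},\ \mathcal{B}x \subset \mathcal{B}\}$ of $\mathcal{B}$ in its second dual $\mathcal{B}^{**}$, viewed as a von Neumann algebra (the universal enveloping von Neumann algebra of $\mathcal{B}$). It is unital, and equals $\mathcal{B}$ when $\mathcal{B}$ is unital. *)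

theory Defs
  imports "HOL-Analysis.Analysis"
begin

section \<open>Complex normed spaces and C*-algebras\<close>

class scaleC =
  fixes scaleC :: "complex \<Rightarrow> 'a \<Rightarrow> 'a" (infixr "*\<^sub>C" 75)

class complex_normed_vector = real_normed_vector + scaleC +
  assumes scaleR_scaleC: "r *\<^sub>R x = complex_of_real r *\<^sub>C x"
    and scaleC_add_right: "c *\<^sub>C (x + y) = c *\<^sub>C x + c *\<^sub>C y"
    and scaleC_add_left: "(c + d) *\<^sub>C x = c *\<^sub>C x + d *\<^sub>C x"
    and scaleC_scaleC: "c *\<^sub>C d *\<^sub>C x = (c * d) *\<^sub>C x"
    and norm_scaleC: "norm (c *\<^sub>C x) = cmod c * norm x"

text \<open>No unit is required. Completeness comes from \<^class>\<open>banach\<close>, submultiplicativity of the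
  norm from \<^class>\<open>real_normed_algebra\<close>; the zero algebra is allowed.\<close>

class cstar_algebra = complex_normed_vector + real_normed_algebra + banach +
  fixes star :: "'a \<Rightarrow> 'a"
  assumes scaleC_mult_left: "(c *\<^sub>C x) * y = c *\<^sub>C (x * y)"
    and scaleC_mult_right: "x * (c *\<^sub>C y) = c *\<^sub>C (x * y)"
    and star_add: "star (x + y) = star x + star y"
    and star_scaleC: "star (c *\<^sub>C x) = cnj c *\<^sub>C star x"
    and star_mult: "star (x * y) = star y * star x"
    and star_star: "star (star x) = x"
    and cstar_identity: "norm (star x * x) = (norm x)\<^sup>2"

instantiation complex :: cstar_algebra
begin
definition scaleC_complex :: "complex \<Rightarrow> complex \<Rightarrow> complex" where
  "scaleC_complex c x = c * x"
definition star_complex :: "complex \<Rightarrow> complex" where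
  "star_complex x = cnj x"
instance
  by standard
    (auto simp: scaleC_complex_def star_complex_def scaleR_conv_of_real algebra_simps
      norm_mult power2_eq_square)
end

lemma scaleC_one [simp]: "1 *\<^sub>C x = (x :: 'a::complex_normed_vector)"
  using scaleR_scaleC[of 1 x] by simp

lemma norm_star: "norm (star x) = norm (x :: 'a::cstar_algebra)"
proof -
  have le: "norm y \<le> norm (star y)" for y :: 'a
  proof (cases "y = 0")
    case False
    have "norm y * norm y \<le> norm (star y) * norm y"
      using cstar_identity[of y] norm_mult_ineq[of "star y" y] by (simp add: power2_eq_square)
    with False show ?thesis by simp
  qed simp
  show ?thesis using le[of x] le[of "star x"] by (simp add: star_star)
qed

section \<open>Linear maps and Jordan *-isomorphisms\<close>

definition complex_linear :: "('a::complex_normed_vector \<Rightarrow> 'b::complex_normed_vector) \<Rightarrow> bool" where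
  "complex_linear f \<longleftrightarrow> (\<forall>x y. f (x + y) = f x + f y) \<and> (\<forall>c x. f (c *\<^sub>C x) = c *\<^sub>C f x)"

definition jordan_product :: "'a::cstar_algebra \<Rightarrow> 'a \<Rightarrow> 'a" where
  "jordan_product x y = (1/2) *\<^sub>C (x * y + y * x)"

definition jordan_star_isomorphism :: "('a::cstar_algebra \<Rightarrow> 'b::cstar_algebra) \<Rightarrow> bool" where
  "jordan_star_isomorphism J \<longleftrightarrow>
     complex_linear J \<and> bij J \<and>
     (\<forall>x y. J (jordan_product x y) = jordan_product (J x) (J y)) \<and>
     (\<forall>x. J (star x) = star (J x))"

section \<open>The dual space\<close>

text \<open>The bounded complex-linear functionals with the operator norm. For a fixed type, the second
  dual is obtained by applying the type constructor twice.\<close>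

typedef (overloaded) ('a::complex_normed_vector) cdual =
    "{f :: 'a \<Rightarrow> complex. bounded_linear f \<and> complex_linear f}"
  morphisms dual_apply CDual
  by (auto simp: complex_linear_def scaleC_complex_def intro!: exI[of _ "\<lambda>_. 0"] bounded_linear_zero)

setup_lifting type_definition_cdual

lemma bounded_linear_dual_apply: "bounded_linear (dual_apply f)"
  using dual_apply[of f] by simp

lemma dual_apply_add: "dual_apply f (x + y) = dual_apply f x + dual_apply f y"
  using dual_apply[of f] by (simp add: complex_linear_def)

lemma dual_apply_scaleC: "dual_apply f (c *\<^sub>C x) = c * dual_apply f x"
  using dual_apply[of f] by (simp add: complex_linear_def scaleC_complex_def)

lemma dual_eqI: "(\<And>x. dual_apply f x = dual_apply g x) \<Longrightarrow> f = g"
  by (simp add: dual_apply_inject[symmetric] fun_eq_iff)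

instantiation cdual :: (complex_normed_vector) complex_normed_vector
begin

lift_definition norm_cdual :: "'a cdual \<Rightarrow> real" is onorm .

lift_definition zero_cdual :: "'a cdual" is "\<lambda>_. 0"
  by (auto simp: complex_linear_def scaleC_complex_def intro!: bounded_linear_zero)

lift_definition plus_cdual :: "'a cdual \<Rightarrow> 'a cdual \<Rightarrow> 'a cdual" is "\<lambda>f g x. f x + g x"
  by (auto simp: complex_linear_def scaleC_complex_def algebra_simps intro!: bounded_linear_add)

lift_definition minus_cdual :: "'a cdual \<Rightarrow> 'a cdual \<Rightarrow> 'a cdual" is "\<lambda>f g x. f x - g x"
  by (auto simp: complex_linear_def scaleC_complex_def algebra_simps intro!: bounded_linear_sub)

lift_definition uminus_cdual :: "'a cdual \<Rightarrow> 'a cdual" is "\<lambda>f x. - f x"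
  by (auto simp: complex_linear_def scaleC_complex_def intro!: bounded_linear_minus)

lift_definition scaleR_cdual :: "real \<Rightarrow> 'a cdual \<Rightarrow> 'a cdual" is "\<lambda>r f x. r *\<^sub>R f x"
  by (auto simp: complex_linear_def scaleC_complex_def algebra_simps
      intro!: bounded_linear_compose[OF bounded_linear_scaleR_right])

lift_definition scaleC_cdual :: "complex \<Rightarrow> 'a cdual \<Rightarrow> 'a cdual" is "\<lambda>c f x. c * f x"
  by (auto simp: complex_linear_def scaleC_complex_def algebra_simps
      intro!: bounded_linear_const_mult)

definition dist_cdual :: "'a cdual \<Rightarrow> 'a cdual \<Rightarrow> real" where
  "dist_cdual f g = norm (f - g)"

definition sgn_cdual :: "'a cdual \<Rightarrow> 'a cdual" where
  "sgn_cdual f = inverse (norm f) *\<^sub>R f"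

definition [code del]:
  "(uniformity :: ('a cdual \<times> 'a cdual) filter) = (INF e\<in>{0 <..}. principal {(x, y). dist x y < e})"

definition open_cdual :: "'a cdual set \<Rightarrow> bool" where [code del]:
  "open_cdual S \<longleftrightarrow> (\<forall>x\<in>S. \<forall>\<^sub>F (x', y) in uniformity. x' = x \<longrightarrow> y \<in> S)"

instance
proof
  fix f g h :: "'a cdual" and r s :: real and c d :: complex
  show "f + g + h = f + (g + h)" "f + g = g + f" "0 + f = f" "- f + f = 0" "f - g = f + - g"
    "r *\<^sub>R (f + g) = r *\<^sub>R f + r *\<^sub>R g" "(r + s) *\<^sub>R f = r *\<^sub>R f + s *\<^sub>R f"
    "r *\<^sub>R s *\<^sub>R f = (r * s) *\<^sub>R f" "1 *\<^sub>R f = f"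
    "r *\<^sub>R f = complex_of_real r *\<^sub>C f"
    "c *\<^sub>C (f + g) = c *\<^sub>C f + c *\<^sub>C g" "(c + d) *\<^sub>C f = c *\<^sub>C f + d *\<^sub>C f"
    "c *\<^sub>C d *\<^sub>C f = (c * d) *\<^sub>C f"
    by (transfer; simp add: algebra_simps scaleR_conv_of_real)+
  show "dist f g = norm (f - g)" by (rule dist_cdual_def)
  show "sgn f = inverse (norm f) *\<^sub>R f" by (rule sgn_cdual_def)
  show "(uniformity :: ('a cdual \<times> 'a cdual) filter) =
      (INF e\<in>{0 <..}. principal {(x, y). dist x y < e})"
    by (rule uniformity_cdual_def)
  fix S :: "'a cdual set"
  show "open S = (\<forall>x\<in>S. \<forall>\<^sub>F (x', y) in uniformity. x' = x \<longrightarrow> y \<in> S)"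
    by (rule open_cdual_def)
next
  fix f g :: "'a cdual" and r :: real and c :: complex
  show "(norm f = 0) = (f = 0)"
    by transfer (auto simp: onorm_eq_0)
  show "norm (f + g) \<le> norm f + norm g"
    by transfer (auto intro: onorm_triangle)
  show "norm (r *\<^sub>R f) = \<bar>r\<bar> * norm f"
    by transfer (auto intro: onorm_scaleR)
  show "norm (c *\<^sub>C f) = cmod c * norm f"
  proof transfer
    fix c :: complex and f :: "'a \<Rightarrow> complex"
    assume "bounded_linear f \<and> complex_linear f"
    then have f: "bounded_linear f" by simp
    have "onorm (\<lambda>x. c * f x) = onorm (\<lambda>x. cmod c *\<^sub>R f x)"
      by (simp add: onorm_def norm_mult)
    then show "onorm (\<lambda>x. c * f x) = cmod c * onorm f"
      by (simp add: onorm_scaleR[OF f])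
  qed
qed

end

lemma norm_dual_apply: "cmod (dual_apply f x) \<le> norm f * norm x"
  by transfer (auto intro: onorm)

lemma norm_dual_bound:
  assumes "0 \<le> K" "\<And>x. cmod (dual_apply f x) \<le> K * norm x"
  shows "norm f \<le> K"
  using assms by transfer (auto intro: onorm_bound)

lemma dual_carrierI:
  fixes f :: "'a::complex_normed_vector \<Rightarrow> complex"
  assumes add: "\<And>x y. f (x + y) = f x + f y" and sc: "\<And>c x. f (c *\<^sub>C x) = c * f x"
    and bd: "\<And>x. cmod (f x) \<le> K * norm x"
  shows "bounded_linear f \<and> complex_linear f"
proof
  show "bounded_linear f"
    by (rule bounded_linear_intro[of _ K])
      (use bd in \<open>auto simp: add scaleR_scaleC[where 'a='a] sc scaleR_conv_of_real mult.commute\<close>)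
  show "complex_linear f" by (simp add: complex_linear_def add sc scaleC_complex_def)
qed

section \<open>The second dual as an algebra\<close>

type_synonym 'a bidual = "'a cdual cdual"

lift_definition bidual_embed :: "'a::complex_normed_vector \<Rightarrow> 'a bidual" is "\<lambda>a f. dual_apply f a"
  subgoal for a
    by (rule dual_carrierI[of _ "norm a"])
      (auto simp: plus_cdual.rep_eq scaleC_cdual.rep_eq mult.commute[of "norm a"] norm_dual_apply)
  done

text \<open>The von Neumann algebra structure of the second dual: its product is the (first) Arens
  product, for which (by the theorem of Sherman and Takeda) the second dual of a C*-algebra is its
  universal enveloping von Neumann algebra. The first and the second Arens product of a C*-algebra
  agree, so choosing the first one is immaterial. It is built in three steps:
  \<open>(f \<cdot> a)(b) = f (a b)\<close>, then \<open>(y \<cdot> f)(a) = y (f \<cdot> a)\<close>, and finally \<open>(x y)(f) = x (y \<cdot> f)\<close>,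
  for \<open>a, b\<close> in the algebra, \<open>f\<close> in the dual and \<open>x, y\<close> in the second dual.\<close>

lift_definition dual_act :: "'a::cstar_algebra cdual \<Rightarrow> 'a \<Rightarrow> 'a cdual" is
  "\<lambda>f a b. dual_apply f (a * b)"
  subgoal for f a
  proof (rule dual_carrierI[of _ "norm f * norm a"])
    fix x
    have "cmod (dual_apply f (a * x)) \<le> norm f * norm (a * x)" by (rule norm_dual_apply)
    also have "\<dots> \<le> norm f * (norm a * norm x)"
      by (intro mult_left_mono norm_mult_ineq norm_ge_zero)
    finally show "cmod (dual_apply f (a * x)) \<le> norm f * norm a * norm x" by (simp add: mult.assoc)
  qed (auto simp: distrib_left scaleC_mult_right dual_apply_add dual_apply_scaleC)
  done

lemma dual_act_add_left: "dual_act (f + g) a = dual_act f a + dual_act g a"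
  by (rule dual_eqI) (simp add: dual_act.rep_eq plus_cdual.rep_eq)

lemma dual_act_scaleC_left: "dual_act (c *\<^sub>C f) a = c *\<^sub>C dual_act f a"
  by (rule dual_eqI) (simp add: dual_act.rep_eq scaleC_cdual.rep_eq)

lemma dual_act_add_right: "dual_act f (a + b) = dual_act f a + dual_act f b"
  by (rule dual_eqI) (simp add: dual_act.rep_eq plus_cdual.rep_eq distrib_right dual_apply_add)

lemma dual_act_scaleC_right: "dual_act f (c *\<^sub>C a) = c *\<^sub>C dual_act f a"
  by (rule dual_eqI)
    (simp add: dual_act.rep_eq scaleC_cdual.rep_eq scaleC_mult_left dual_apply_scaleC)

lemma norm_dual_act: "norm (dual_act f a) \<le> norm f * norm a"
proof (rule norm_dual_bound)
  fix x
  have "cmod (dual_apply f (a * x)) \<le> norm f * norm (a * x)" by (rule norm_dual_apply)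
  also have "\<dots> \<le> norm f * (norm a * norm x)"
    by (intro mult_left_mono norm_mult_ineq norm_ge_zero)
  finally show "cmod (dual_apply (dual_act f a) x) \<le> norm f * norm a * norm x"
    by (simp add: dual_act.rep_eq mult.assoc)
qed simp

lift_definition bidual_act :: "'a::cstar_algebra bidual \<Rightarrow> 'a cdual \<Rightarrow> 'a cdual" is
  "\<lambda>y f a. dual_apply y (dual_act f a)"
  subgoal for y f
  proof (rule dual_carrierI[of _ "norm y * norm f"])
    fix a
    have "cmod (dual_apply y (dual_act f a)) \<le> norm y * norm (dual_act f a)"
      by (rule norm_dual_apply)
    also have "\<dots> \<le> norm y * (norm f * norm a)"
      by (intro mult_left_mono norm_dual_act norm_ge_zero)
    finally show "cmod (dual_apply y (dual_act f a)) \<le> norm y * norm f * norm a"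
      by (simp add: mult.assoc)
  qed (auto simp: dual_act_add_right dual_act_scaleC_right dual_apply_add dual_apply_scaleC)
  done

lemma norm_bidual_act: "norm (bidual_act y f) \<le> norm y * norm f"
proof (rule norm_dual_bound)
  fix a
  have "cmod (dual_apply y (dual_act f a)) \<le> norm y * norm (dual_act f a)"
    by (rule norm_dual_apply)
  also have "\<dots> \<le> norm y * (norm f * norm a)"
    by (intro mult_left_mono norm_dual_act norm_ge_zero)
  finally show "cmod (dual_apply (bidual_act y f) a) \<le> norm y * norm f * norm a"
    by (simp add: bidual_act.rep_eq mult.assoc)
qed simp

lemma bidual_act_add_right: "bidual_act y (f + g) = bidual_act y f + bidual_act y g"
  by (rule dual_eqI)
    (simp add: bidual_act.rep_eq plus_cdual.rep_eq dual_act_add_left dual_apply_add)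

lemma bidual_act_scaleC_right: "bidual_act y (c *\<^sub>C f) = c *\<^sub>C bidual_act y f"
  by (rule dual_eqI)
    (simp add: bidual_act.rep_eq scaleC_cdual.rep_eq dual_act_scaleC_left dual_apply_scaleC)

lift_definition bidual_mult :: "'a::cstar_algebra bidual \<Rightarrow> 'a bidual \<Rightarrow> 'a bidual"
    (infixl "\<box>" 70) is "\<lambda>x y f. dual_apply x (bidual_act y f)"
  subgoal for x y
  proof (rule dual_carrierI[of _ "norm x * norm y"])
    fix f
    have "cmod (dual_apply x (bidual_act y f)) \<le> norm x * norm (bidual_act y f)"
      by (rule norm_dual_apply)
    also have "\<dots> \<le> norm x * (norm y * norm f)"
      by (intro mult_left_mono norm_bidual_act norm_ge_zero)
    finally show "cmod (dual_apply x (bidual_act y f)) \<le> norm x * norm y * norm f"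
      by (simp add: mult.assoc)
  qed (auto simp: bidual_act_add_right bidual_act_scaleC_right dual_apply_add dual_apply_scaleC)
  done

text \<open>The involution of the second dual is \<open>x*(f) = cnj (x (f*))\<close>, where
  \<open>f*(a) = cnj (f (a*))\<close>.\<close>

lift_definition dual_star :: "'a::cstar_algebra cdual \<Rightarrow> 'a cdual" is
  "\<lambda>f a. cnj (dual_apply f (star a))"
  subgoal for f
    by (rule dual_carrierI[of _ "norm f"])
      (use norm_dual_apply[of f "star _"] in
        \<open>auto simp: star_add star_scaleC dual_apply_add dual_apply_scaleC norm_star\<close>)
  done

lemma norm_dual_star: "norm (dual_star f) \<le> norm f"
  by (rule norm_dual_bound)
    (use norm_dual_apply[of f "star _"] in \<open>auto simp: dual_star.rep_eq norm_star\<close>)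

lift_definition bidual_star :: "'a::cstar_algebra bidual \<Rightarrow> 'a bidual" is
  "\<lambda>x f. cnj (dual_apply x (dual_star f))"
  subgoal for x
  proof (rule dual_carrierI[of _ "norm x"])
    fix f g :: "'a cdual" and c
    have "dual_star (f + g) = dual_star f + dual_star g"
      by (rule dual_eqI) (simp add: dual_star.rep_eq plus_cdual.rep_eq)
    then show "cnj (dual_apply x (dual_star (f + g))) =
        cnj (dual_apply x (dual_star f)) + cnj (dual_apply x (dual_star g))"
      by (simp add: dual_apply_add)
    have "dual_star (c *\<^sub>C f) = cnj c *\<^sub>C dual_star f"
      by (rule dual_eqI) (simp add: dual_star.rep_eq scaleC_cdual.rep_eq)
    then show "cnj (dual_apply x (dual_star (c *\<^sub>C f))) = c * cnj (dual_apply x (dual_star f))"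
      by (simp add: dual_apply_scaleC)
    have "cmod (dual_apply x (dual_star f)) \<le> norm x * norm (dual_star f)"
      by (rule norm_dual_apply)
    also have "\<dots> \<le> norm x * norm f"
      by (intro mult_left_mono norm_dual_star norm_ge_zero)
    finally show "cmod (cnj (dual_apply x (dual_star f))) \<le> norm x * norm f" by simp
  qed
  done

lemma bidual_embed_mult: "bidual_embed (a * b) = bidual_embed a \<box> bidual_embed b"
  by (rule dual_eqI)
    (simp add: bidual_embed.rep_eq bidual_mult.rep_eq bidual_act.rep_eq dual_act.rep_eq)

lemma bidual_embed_star: "bidual_embed (star a) = bidual_star (bidual_embed a)"
  by (rule dual_eqI) (simp add: bidual_embed.rep_eq bidual_star.rep_eq dual_star.rep_eq)

lemma bidual_mult_assoc: "x \<box> y \<box> z = x \<box> (y \<box> z)"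
proof (rule dual_eqI)
  fix f :: "'a cdual"
  have 1: "dual_act (dual_act f a) b = dual_act f (a * b)" for a b :: 'a and f
    by (rule dual_eqI) (simp add: dual_act.rep_eq mult.assoc)
  have 2: "dual_act (bidual_act z f) a = bidual_act z (dual_act f a)" for a :: 'a
    by (rule dual_eqI) (simp add: dual_act.rep_eq bidual_act.rep_eq 1)
  have "bidual_act y (bidual_act z f) = bidual_act (y \<box> z) f"
    by (rule dual_eqI) (simp add: bidual_act.rep_eq bidual_mult.rep_eq 2)
  then show "dual_apply (x \<box> y \<box> z) f = dual_apply (x \<box> (y \<box> z)) f"
    by (simp add: bidual_mult.rep_eq)
qed

section \<open>The multiplier algebra and its unitaries\<close>

text \<open>The idealizer of a C*-algebra, embedded canonically, in its second dual.\<close>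

definition multiplier_algebra :: "'a::cstar_algebra bidual set" where
  "multiplier_algebra =
     {x. \<forall>b. x \<box> bidual_embed b \<in> range bidual_embed \<and> bidual_embed b \<box> x \<in> range bidual_embed}"

lemma bidual_embed_in_multiplier_algebra: "bidual_embed a \<in> multiplier_algebra"
  by (auto simp: multiplier_algebra_def bidual_embed_mult[symmetric])

definition is_multiplier_unit :: "'a::cstar_algebra bidual \<Rightarrow> bool" where
  "is_multiplier_unit e \<longleftrightarrow>
     e \<in> multiplier_algebra \<and> (\<forall>x\<in>multiplier_algebra. e \<box> x = x \<and> x \<box> e = x)"

text \<open>The multiplier algebra has exactly one unit, so the following says \<open>u*u = uu* = 1\<close>.\<close>

definition multiplier_unitary :: "'a::cstar_algebra bidual \<Rightarrow> bool" where
  "multiplier_unitary u \<longleftrightarrow>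
     u \<in> multiplier_algebra \<and>
     is_multiplier_unit (bidual_star u \<box> u) \<and> is_multiplier_unit (u \<box> bidual_star u)"

end

theory Submission
  imports Defs
begin

text \<open>For every \<open>a\<close> the vector field \<open>x \<mapsto> a - x a\<^sup>* x\<close> is tangent to the unit sphere of a
  C*-algebra. Conjugating it with \<open>T\<close> and subtracting the field of \<open>T a\<close> leaves a homogeneous
  quadratic field that is still tangent to the sphere; its complex flow is bounded, so by
  Liouville's theorem it vanishes: \<open>T (x a\<^sup>* x) = T x (T a)\<^sup>* T x\<close>.
  Now let \<open>e\<close> run through the approximate units of the domain and put \<open>v = T e\<close>. In the limit the
  triple product identity becomes \<open>w v\<^sup>* b + b v\<^sup>* w \<rightarrow> 2 b\<close> for two independent such \<open>v, w\<close>, and a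
  positivity argument separates the two terms: \<open>w v\<^sup>* b \<rightarrow> b\<close> and \<open>v\<^sup>* w b \<rightarrow> b\<close>. Hence \<open>v\<close> and
  \<open>v\<^sup>*\<close> converge strictly, the limit of \<open>v\<close> is the unitary \<open>u\<close>, and \<open>J x = lim v\<^sup>* T x\<close>.
  Positivity is treated without spectral theory: positive elements are squares of self-adjoint
  ones, and square roots are limits of an explicit iteration.\<close>

section \<open>Elementary rules\<close>

text \<open>In a C*-algebra without unit the closed unit ball has no extreme points, so there is no
  \<open>T 1\<close> to start from, and its role passes to a limit that must be caught in the second
  dual. Tangency of a vector field is a statement about norms alone and hence survives conjugation
  with \<open>T\<close>; the constant terms \<open>T a\<close> of the two fields cancel, and the
  rest is quadratic because \<open>a\<close> stays fixed. Two independent approximate units are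
  essential: with \<open>v = w\<close> one would only learn that \<open>v\<close> is asymptotically
  unitary, whereas for independent indices \<open>w v* b\<close> close to \<open>b\<close> compares
  different values of \<open>T e\<close> and makes them Cauchy. The separation of the two terms is a
  quantitative form of the extremality of 1: if the mean of two contractions tends to 1, both do.
  The difficulty is that here one of them acts from the left and the other from the right.\<close>

lemma star_minus: "star (- x) = - star (x :: 'a::cstar_algebra)"
  using star_add[of x "- x"] star_add[of 0 "0::'a"] by (simp add: eq_neg_iff_add_eq_0 add.commute)

lemma star_zero [simp]: "star 0 = (0 :: 'a::cstar_algebra)"
  using star_add[of 0 "0::'a"] by simp

lemma star_diff: "star (x - y) = star x - star (y :: 'a::cstar_algebra)"
  using star_add[of x "- y"] by (simp add: star_minus)

lemma star_scaleR: "star (r *\<^sub>R x) = r *\<^sub>R star (x :: 'a::cstar_algebra)"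
  by (simp add: scaleR_scaleC star_scaleC)

lemma bounded_linear_star: "bounded_linear (star :: 'a::cstar_algebra \<Rightarrow> 'a)"
  by (rule bounded_linear_intro[of _ 1]) (auto simp: star_add star_scaleR norm_star)

lemmas tendsto_star = bounded_linear.tendsto[OF bounded_linear_star]

lemma bounded_linear_scaleC: "bounded_linear (\<lambda>x :: 'a::complex_normed_vector. c *\<^sub>C x)"
  by (rule bounded_linear_intro[of _ "cmod c"])
    (auto simp: scaleC_add_right scaleR_scaleC scaleC_scaleC norm_scaleC mult.commute)

lemmas linear_scaleC = bounded_linear.linear[OF bounded_linear_scaleC]

lemmas scaleC_zero_right [simp] = linear_0[OF linear_scaleC]
  and scaleC_diff_right = linear_diff[OF linear_scaleC]
  and tendsto_scaleC = bounded_linear.tendsto[OF bounded_linear_scaleC]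

lemma scaleC_zero_left [simp]: "0 *\<^sub>C (x :: 'a::complex_normed_vector) = 0"
  using scaleR_scaleC[of 0 x] by simp

lemma scaleC_minus_left: "(- c) *\<^sub>C (x :: 'a::complex_normed_vector) = - (c *\<^sub>C x)"
  using scaleC_add_left[of "- c" c x] by (simp add: eq_neg_iff_add_eq_0)

lemma norm_star_mult: "norm (x * star x) = (norm (x :: 'a::cstar_algebra))\<^sup>2"
  using cstar_identity[of "star x"] by (simp add: star_star norm_star)

lemma norm_selfadjoint_square:
  "star x = x \<Longrightarrow> norm (x * x) = (norm (x :: 'a::cstar_algebra))\<^sup>2"
  using cstar_identity[of x] by simp

lemma selfadjoint_decomposition:
  fixes x :: "'a::cstar_algebra"
  obtains h k where "star h = h" "star k = k" "x = h + \<i> *\<^sub>C k"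
proof
  let ?h = "(1/2) *\<^sub>R (x + star x)" and ?k = "(- \<i> / 2) *\<^sub>C (x - star x)"
  show "star ?h = ?h" by (simp add: star_scaleR star_add star_star add.commute)
  show "star ?k = ?k"
    by (simp add: star_scaleC star_minus star_diff star_star scaleC_minus_left scaleC_diff_right)
  have "\<i> *\<^sub>C ?k = (1/2) *\<^sub>R (x - star x)"
    by (simp add: scaleC_scaleC scaleR_scaleC)
  then show "x = ?h + \<i> *\<^sub>C ?k"
    by (simp add: algebra_simps flip: scaleR_add_left)
qed

section \<open>Positive elements\<close>

text \<open>The order theory is developed with a unit, where \<open>of_real r - a\<close> makes
  sense, and reaches arbitrary algebras through \<open>emb\<close>.\<close>

class cstar_algebra_1 = cstar_algebra + real_normed_algebra_1

lemma star_one [simp]: "star 1 = (1 :: 'a::cstar_algebra_1)"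
  by (metis mult.left_neutral star_mult star_star)

lemma star_of_real [simp]: "star (of_real r) = (of_real r :: 'a::cstar_algebra_1)"
  by (simp add: of_real_def star_scaleR)

lemma star_power: "star (x ^ n) = (star x :: 'a::cstar_algebra_1) ^ n"
  by (induction n) (auto simp: star_mult power_commutes)

lemma of_real_commute: "of_real r * x = x * (of_real r :: 'a::real_algebra_1)"
  by (simp add: of_real_def)

text \<open>The iteration \<open>y \<mapsto> (x + y\<^sup>2) / 2\<close> converges to a solution \<open>y\<close> of \<open>(1 - y)\<^sup>2 = 1 - x\<close>; its
  increments are dominated by those of the same iteration for the scalar \<open>x = 1\<close>.\<close>

lemma square_root_one_minus:
  fixes x :: "'a::cstar_algebra_1"
  assumes sa: "star x = x" and le: "norm x \<le> 1"
  obtains b where "star b = b" "b * b = 1 - x" "norm (1 - b) \<le> 1"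
    "\<forall>y. y * x = x * y \<longrightarrow> y * b = b * y"
proof -
  define Y where "Y = rec_nat (0::'a) (\<lambda>_ y. (1/2) *\<^sub>R (x + y * y))"
  define s where "s = rec_nat (0::real) (\<lambda>_ y. (1/2) * (1 + y * y))"
  have Y0: "Y 0 = 0" and YS: "\<And>n. Y (Suc n) = (1/2) *\<^sub>R (x + Y n * Y n)"
    by (simp_all add: Y_def)
  have s0: "s 0 = 0" and sS: "\<And>n. s (Suc n) = (1/2) * (1 + s n * s n)"
    by (simp_all add: s_def)
  have s_bd: "0 \<le> s n \<and> s n \<le> 1" for n
    by (induction n) (auto simp: s0 sS mult_le_one)
  have Y_bd: "norm (Y n) \<le> s n" for n
  proof (induction n)
    case (Suc n)
    have "norm (x + Y n * Y n) \<le> 1 + s n * s n"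
      using norm_triangle_ineq[of x "Y n * Y n"] norm_mult_ineq[of "Y n" "Y n"] le
        mult_mono[OF Suc Suc] s_bd[of n] by simp
    then show ?case by (simp add: YS sS)
  qed (simp add: Y0 s0)
  have inc: "norm (Y (Suc n) - Y n) \<le> s (Suc n) - s n" for n
  proof (induction n)
    case 0
    show ?case using le by (simp add: Y0 s0 YS sS)
  next
    case (Suc n)
    \<comment> \<open>A difference of squares of elements not yet known to commute: each term keeps
      the previous increment as a factor, as in the scalar recursion.\<close>
    have eq: "Y (Suc (Suc n)) - Y (Suc n) = (1/2) *\<^sub>R
        ((Y (Suc n) - Y n) * Y (Suc n) + Y n * (Y (Suc n) - Y n))"
      unfolding YS[of "Suc n"] YS[of n] by (simp add: algebra_simps)
    have "norm ((Y (Suc n) - Y n) * Y (Suc n) + Y n * (Y (Suc n) - Y n))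
        \<le> norm (Y (Suc n) - Y n) * norm (Y (Suc n)) + norm (Y n) * norm (Y (Suc n) - Y n)"
      by (meson norm_triangle_le add_mono norm_mult_ineq)
    also have "\<dots> \<le> (s (Suc n) - s n) * s (Suc n) + s n * (s (Suc n) - s n)"
      by (intro add_mono mult_mono Suc Y_bd) (use Suc s_bd norm_ge_zero order_trans in blast)+
    also have "\<dots> = 2 * (s (Suc (Suc n)) - s (Suc n))"
      unfolding sS[of "Suc n"] sS[of n] by (simp add: algebra_simps)
    finally show ?case unfolding eq by simp
  qed
  have "summable (\<lambda>n. s (Suc n) - s n)"
  proof (rule summableI_nonneg_bounded)
    show "0 \<le> s (Suc n) - s n" for n using inc[of n] norm_ge_zero order_trans by blast
    show "(\<Sum>i<n. s (Suc i) - s i) \<le> 1" for n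
      using s_bd[of n] by (simp add: sum_lessThan_telescope s0)
  qed
  then have "summable (\<lambda>n. Y (Suc n) - Y n)"
    by (rule summable_comparison_test'[where N = 0]) (use inc in auto)
  then obtain l where "(\<lambda>n. \<Sum>i<n. Y (Suc i) - Y i) \<longlonglongrightarrow> l"
    by (auto simp: summable_def sums_def)
  then have lim: "Y \<longlonglongrightarrow> l" by (simp add: sum_lessThan_telescope Y0)
  have "(\<lambda>n. Y (Suc n)) \<longlonglongrightarrow> (1/2) *\<^sub>R (x + l * l)"
    unfolding YS by (intro tendsto_intros lim)
  with LIMSEQ_Suc[OF lim] have l: "l = (1/2) *\<^sub>R (x + l * l)"
    by (rule LIMSEQ_unique)
  have "2 *\<^sub>R l = x + l * l" by (subst l) simp
  then have l2: "l * l = l + l - x" by (simp add: scaleR_2 algebra_simps)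
  have "star (Y n) = Y n" for n
    by (induction n) (auto simp: Y0 YS star_scaleR star_add star_mult sa)
  then have "star l = l"
    using LIMSEQ_unique[OF tendsto_star[OF lim] ] lim by simp
  \<comment> \<open>Since \<open>b = 1 - l\<close>, this is the bound on \<open>1 - b\<close>; it
    later certifies that the root is itself positive.\<close>
  moreover have "norm l \<le> 1"
    by (rule Lim_bounded[OF tendsto_norm[OF lim], of 0]) (use Y_bd s_bd order_trans in blast)
  moreover have "y * l = l * y" if y: "y * x = x * y" for y
  proof -
    have c: "y * Y n = Y n * y" for n
    proof (induction n)
      case (Suc n)
      have "y * (Y n * Y n) = Y n * Y n * y"
        by (metis Suc mult.assoc)
      then show ?case by (simp add: YS algebra_simps y)
    qed (simp add: Y0)
    have "(\<lambda>n. y * Y n) \<longlonglongrightarrow> y * l" "(\<lambda>n. Y n * y) \<longlonglongrightarrow> l * y"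
      by (intro tendsto_intros lim)+
    then show ?thesis unfolding c by (rule LIMSEQ_unique)
  qed
  ultimately show thesis
    by (intro that[of "1 - l"] allI impI) (auto simp: star_diff algebra_simps l2)
qed

text \<open>Rescaling to \<open>x = 1 - a / r\<close>. The norm hypothesis says that the spectrum of
  \<open>a\<close> lies in \<open>[0, 2 r]\<close>; the root satisfies a condition of the same form,
  so roots can be taken repeatedly.\<close>

lemma square_root:
  fixes a :: "'a::cstar_algebra_1"
  assumes sa: "star a = a" and le: "norm (of_real r - a) \<le> r"
  obtains b where "star b = b" "b * b = a" "norm (of_real (sqrt r) - b) \<le> sqrt r"
    "\<forall>y. y * a = a * y \<longrightarrow> y * b = b * y"
proof (cases "r = 0")
  case True
  with le have "a = 0" by simp
  with True show thesis by (intro that[of 0]) auto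
next
  case False
  have r: "r > 0" using le False norm_ge_zero[of "of_real r - a"] by linarith
  let ?x = "(1/r) *\<^sub>R (of_real r - a)"
  have x: "1 - ?x = (1/r) *\<^sub>R a" using r by (simp add: of_real_def scaleR_diff_right)
  have "star ?x = ?x" by (simp add: star_scaleR star_diff sa)
  moreover have "norm ?x \<le> 1" using r le by (simp add: divide_simps)
  ultimately obtain b where b: "star b = b" "b * b = 1 - ?x" "norm (1 - b) \<le> 1"
    "\<forall>y. y * ?x = ?x * y \<longrightarrow> y * b = b * y"
    by (rule square_root_one_minus)
  show thesis
  proof (rule that[of "sqrt r *\<^sub>R b"])
    show "star (sqrt r *\<^sub>R b) = sqrt r *\<^sub>R b" by (simp add: star_scaleR b)
    show "sqrt r *\<^sub>R b * sqrt r *\<^sub>R b = a"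
      unfolding mult_scaleR_left mult_scaleR_right b(2) x using r by simp
    have "of_real (sqrt r) - sqrt r *\<^sub>R b = sqrt r *\<^sub>R (1 - b)"
      by (simp add: of_real_def scaleR_diff_right)
    then show "norm (of_real (sqrt r) - sqrt r *\<^sub>R b) \<le> sqrt r"
      using b(3) r by (simp add: mult_left_le)
    have "y * sqrt r *\<^sub>R b = sqrt r *\<^sub>R b * y" if "y * a = a * y" for y
      using b(4)[rule_format, of y] that by (simp add: algebra_simps of_real_commute)
    then show "\<forall>y. y * a = a * y \<longrightarrow> y * sqrt r *\<^sub>R b = sqrt r *\<^sub>R b * y" by blast
  qed
qed

text \<open>Because \<open>b\<close> and \<open>s\<close> commute, \<open>u = b + i s\<close>
  satisfies \<open>star u * u = of_real r\<close>, and \<open>s\<close> is the imaginary part of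
  \<open>u\<close>, so its norm is at most that of \<open>u\<close>.\<close>

lemma norm_square_le_of_sum_squares:
  fixes b s :: "'a::cstar_algebra_1"
  assumes "star b = b" "star s = s" "b * s = s * b" "b * b + s * s = of_real r"
    and r: "0 \<le> r"
  shows "norm (s * s) \<le> r"
proof -
  define u where "u = b + \<i> *\<^sub>C s"
  have u': "star u = b - \<i> *\<^sub>C s"
    by (simp add: u_def star_add star_scaleC assms scaleC_minus_left)
  have "star u * u = of_real r"
    unfolding u' unfolding u_def
    by (simp add: algebra_simps scaleC_mult_left scaleC_mult_right scaleC_scaleC
        scaleC_minus_left scaleC_diff_right scaleC_add_right assms(3) flip: assms(4))
  then have nu: "(norm u)\<^sup>2 = \<bar>r\<bar>" using cstar_identity[of u] by simp
  have "u - star u = (2 * \<i>) *\<^sub>C s"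
    unfolding u' unfolding u_def using scaleC_add_left[of \<i> \<i> s] by simp
  then have "2 * norm s = norm (u - star u)" by (simp add: norm_scaleC norm_mult)
  also have "\<dots> \<le> 2 * norm u" using norm_triangle_ineq4[of u "star u"] by (simp add: norm_star)
  finally have "(norm s)\<^sup>2 \<le> (norm u)\<^sup>2" by (simp add: power_mono)
  then show ?thesis using nu r assms(2) by (simp add: norm_selfadjoint_square)
qed

section \<open>The positive cone and its norm criterion\<close>

definition positive :: "'a::cstar_algebra_1 \<Rightarrow> bool" where
  "positive a \<longleftrightarrow> (\<exists>b. star b = b \<and> a = b * b)"

lemma positiveE:
  assumes "positive a" obtains b where "star b = b" "a = b * b"
  using assms by (auto simp: positive_def)

lemma positive_selfadjoint: "positive a \<Longrightarrow> star a = a"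
  by (auto simp: positive_def star_mult)

lemma positive_square: "star b = b \<Longrightarrow> positive (b * b)"
  by (auto simp: positive_def)

lemma positiveI_norm:
  assumes "star a = a" "norm (of_real r - a) \<le> r" shows "positive a"
proof -
  obtain b where "star b = b" "b * b = a" using assms by (rule square_root)
  then show ?thesis using positive_square[of b] by simp
qed

lemma positive_of_real_diff: "star a = a \<Longrightarrow> norm a \<le> r \<Longrightarrow> positive (of_real r - a)"
  by (rule positiveI_norm[of _ r]) (auto simp: star_diff)

text \<open>Converse of \<open>positiveI_norm\<close>. Together they turn positivity into a norm
  inequality, so that closure under sums becomes the triangle inequality. The root \<open>s\<close>
  of \<open>of_real r - a\<close> commutes with \<open>b\<close>, and the squares of
  \<open>b\<close> and \<open>s\<close> add up to \<open>r\<close>.\<close>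

lemma norm_of_real_diff_le:
  assumes "positive a" "norm a \<le> r"
  shows "norm (of_real r - a) \<le> r"
proof -
  obtain b where b: "star b = b" "a = b * b" using assms(1) by (rule positiveE)
  have r: "0 \<le> r" using assms(2) norm_ge_zero order_trans by blast
  have "star (of_real r - a) = of_real r - a"
    using assms(1) by (simp add: star_diff positive_selfadjoint)
  moreover have "norm (of_real r - (of_real r - a)) \<le> r" using assms by simp
  ultimately obtain s where s: "star s = s" "s * s = of_real r - a"
    "\<forall>y. y * (of_real r - a) = (of_real r - a) * y \<longrightarrow> y * s = s * y"
    by (rule square_root)
  have "b * s = s * b"
    by (rule s(3)[rule_format]) (simp add: b algebra_simps of_real_commute)
  then have "norm (s * s) \<le> r"
    by (rule norm_square_le_of_sum_squares[OF b(1) s(1)]) (simp_all add: s(2) b(2) r)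
  then show ?thesis by (simp add: s)
qed

lemma positive_square_root:
  assumes "positive a"
  obtains b where "positive b" "b * b = a" "\<forall>y. y * a = a * y \<longrightarrow> y * b = b * y"
proof -
  obtain b where b: "star b = b" "b * b = a"
    "norm (of_real (sqrt (norm a)) - b) \<le> sqrt (norm a)"
    "\<forall>y. y * a = a * y \<longrightarrow> y * b = b * y"
    using square_root[OF positive_selfadjoint[OF assms] norm_of_real_diff_le[OF assms order_refl]] .
  show thesis by (rule that[OF positiveI_norm[OF b(1,3)] b(2,4)])
qed

lemma positive_zero [simp]: "positive 0"
  using positive_square[of 0] by simp

lemma positive_add:
  assumes "positive a" "positive b" shows "positive (a + b)"
proof (rule positiveI_norm)
  show "star (a + b) = a + b" using assms by (simp add: star_add positive_selfadjoint)
  have "of_real (norm a + norm b) - (a + b) = (of_real (norm a) - a) + (of_real (norm b) - b)"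
    by simp
  also have "norm \<dots> \<le> norm a + norm b"
    by (rule norm_triangle_mono; rule norm_of_real_diff_le; simp add: assms)
  finally show "norm (of_real (norm a + norm b) - (a + b)) \<le> norm a + norm b" .
qed

lemma positive_sum: "(\<And>i. i \<in> A \<Longrightarrow> positive (f i)) \<Longrightarrow> positive (sum f A)"
  by (induction A rule: infinite_finite_induct) (auto intro: positive_add)

lemma positive_scaleR:
  assumes "0 \<le> r" "positive a" shows "positive (r *\<^sub>R a)"
proof -
  obtain b where b: "star b = b" "a = b * b" using assms(2) by (rule positiveE)
  have "r *\<^sub>R a = (sqrt r *\<^sub>R b) * (sqrt r *\<^sub>R b)" using assms(1) b(2) by simp
  also have "positive \<dots>" by (rule positive_square) (simp add: star_scaleR b(1))
  finally show ?thesis .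
qed

lemma positive_one [simp]: "positive 1"
  using positive_square[of 1] by simp

lemma norm_le_of_positive_diff:
  assumes "positive a" "positive (of_real r - a)" "0 \<le> r"
  shows "norm a \<le> r"
proof -
  obtain c where c: "star c = c" "of_real r - a = c * c" using assms(2) by (rule positiveE)
  obtain b where b: "positive b" "b * b = a" "\<forall>y. y * a = a * y \<longrightarrow> y * b = b * y"
    using positive_square_root[OF assms(1)] .
  have a: "a = of_real r - c * c" by (simp flip: c(2))
  have "c * b = b * c"
    by (rule b(3)[rule_format]) (simp add: a algebra_simps of_real_commute)
  then have "norm (b * b) \<le> r"
    by (rule norm_square_le_of_sum_squares[OF c(1) positive_selfadjoint[OF b(1)]])
      (simp_all add: b(2) assms(3) flip: c(2))
  then show ?thesis by (simp add: b)
qed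

lemma norm_le_of_positive_diff_1:
  "positive a \<Longrightarrow> positive (1 - a) \<Longrightarrow> norm a \<le> 1"
  using norm_le_of_positive_diff[of a 1] by simp

lemma norm_mono_positive:
  assumes "positive a" "positive (b - a)"
  shows "norm a \<le> norm b"
proof (rule norm_le_of_positive_diff)
  have "positive b" using positive_add[OF assms] by simp
  then have "positive (of_real (norm b) - b)"
    by (intro positive_of_real_diff positive_selfadjoint) auto
  from positive_add[OF this assms(2)] show "positive (of_real (norm b) - a)" by simp
qed (use assms in auto)

text \<open>The commutation clause of \<open>positive_square_root\<close>, used twice, makes the two
  roots commute; their product is then a self-adjoint root of \<open>a * b\<close>.\<close>

lemma positive_mult_commuting:
  assumes "positive a" "positive b" "a * b = b * a"
  shows "positive (a * b)"
proof -
  obtain c where c: "positive c" "c * c = a" "\<forall>y. y * a = a * y \<longrightarrow> y * c = c * y"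
    using positive_square_root[OF assms(1)] .
  obtain d where d: "positive d" "d * d = b" "\<forall>y. y * b = b * y \<longrightarrow> y * d = d * y"
    using positive_square_root[OF assms(2)] .
  have "b * c = c * b" using assms(3) by (intro c(3)[rule_format]) simp
  then have cd: "c * d = d * c" by (intro d(3)[rule_format]) simp
  have "a * b = (c * d) * (c * d)"
    by (metis c(2) cd d(2) mult.assoc)
  moreover have "star (c * d) = c * d"
    using c(1) d(1) cd by (simp add: star_mult positive_selfadjoint)
  ultimately show ?thesis using positive_square[of "c * d"] by simp
qed

lemma positive_power: "positive a \<Longrightarrow> positive (a ^ n)"
  by (induction n) (auto intro!: positive_mult_commuting simp: power_commutes)

text \<open>Replaces the comparison of the spectra of \<open>y* y\<close> and \<open>y y*\<close>.
  With \<open>c = - y* y\<close> and \<open>p = y y*\<close> one has \<open>y c = - p y\<close>,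
  hence \<open>y (1 + c')^n = (1 - p')^n y\<close> after division by \<open>r = norm p\<close>. The
  right side stays bounded since \<open>1 - p'\<close> is a contraction, but
  \<open>c (1 + c')^n\<close> grows at least like \<open>n c c'\<close> unless
  \<open>c = 0\<close>.\<close>

lemma negative_star_mult_imp_zero:
  fixes y :: "'a::cstar_algebra_1"
  assumes neg: "positive (- (star y * y))"
  shows "star y * y = 0"
proof (rule ccontr)
  assume nz: "star y * y \<noteq> 0"
  define c where "c = - (star y * y)"
  define p where "p = y * star y"
  obtain h k where h: "star h = h" and k: "star k = k" and y: "y = h + \<i> *\<^sub>C k"
    by (rule selfadjoint_decomposition)
  have y': "star y = h - \<i> *\<^sub>C k"
    by (simp add: y star_add star_scaleC h k scaleC_minus_left)
  \<comment> \<open>In \<open>y y* + y* y\<close> the mixed terms in \<open>h\<close> and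
    \<open>k\<close> cancel. This makes \<open>p\<close> positive, which the contraction bound for
    \<open>1 - p'\<close> requires.\<close>
  have "p - c = 2 *\<^sub>R (h * h) + 2 *\<^sub>R (k * k)"
    unfolding p_def c_def y' unfolding y
    by (simp add: algebra_simps scaleC_mult_left scaleC_mult_right scaleC_scaleC scaleR_2
        scaleC_minus_left scaleC_diff_right scaleC_add_right)
  then have "positive (p - c)"
    by (simp only:) (intro positive_add positive_scaleR positive_square h k; simp)
  with neg have p: "positive p"
    using positive_add[of "p - c" c] by (simp add: c_def)
  have c: "positive c" using neg by (simp add: c_def)
  define r where "r = norm p"
  have "y \<noteq> 0" using nz by auto
  then have "r > 0" using norm_star_mult[of y] by (simp add: r_def p_def)
  define c' where "c' = (1/r) *\<^sub>R c"
  define p' where "p' = (1/r) *\<^sub>R p"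
  have c': "positive c'" using c \<open>r > 0\<close> by (simp add: c'_def positive_scaleR)
  have "1 - p' = (1/r) *\<^sub>R (of_real r - p)"
    using \<open>r > 0\<close> by (simp add: p'_def of_real_def scaleR_diff_right)
  then have p': "norm (1 - p') \<le> 1"
    using \<open>r > 0\<close> norm_of_real_diff_le[OF p, of r] by (simp add: r_def)
  have "y * c = - p * y" by (simp add: c_def p_def mult.assoc)
  then have swap: "y * (1 + c') = (1 - p') * y"
    by (simp add: c'_def p'_def algebra_simps)
  have swapn: "y * (1 + c') ^ n = (1 - p') ^ n * y" for n
  proof (induction n)
    case (Suc n)
    have "y * (1 + c') ^ Suc n = (y * (1 + c')) * (1 + c') ^ n" by (simp add: mult.assoc)
    also have "\<dots> = (1 - p') * (y * (1 + c') ^ n)" by (simp add: swap mult.assoc)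
    finally show ?case by (simp add: Suc mult.assoc)
  qed simp
  have bound: "norm (c * (1 + c') ^ n) \<le> (norm y)\<^sup>2" for n
  proof -
    have le1: "norm ((1 - p') ^ n) \<le> 1"
      using norm_power_ineq[of "1 - p'" n] p' by (meson norm_ge_zero order_trans power_le_one)
    have "norm (c * (1 + c') ^ n) = norm (star y * ((1 - p') ^ n * y))"
      by (simp add: c_def mult.assoc flip: swapn)
    also have "\<dots> \<le> norm (star y) * (norm ((1 - p') ^ n) * norm y)"
      by (meson mult_left_mono norm_ge_zero norm_mult_ineq order_trans)
    also have "\<dots> \<le> norm (star y) * (1 * norm y)"
      by (intro mult_left_mono mult_right_mono le1) auto
    finally show ?thesis by (simp add: norm_star power2_eq_square)
  qed
  \<comment> \<open>Bernoulli's inequality multiplied by \<open>c\<close>; all factors commute, so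
    products of positive elements remain positive.\<close>
  have lower: "positive (c * (1 + c') ^ n - of_nat n *\<^sub>R (c * c'))" for n
  proof (induction n)
    case 0
    show ?case using c by simp
  next
    case (Suc n)
    have cc: "c * c' = c' * c" by (simp add: c'_def)
    have cc2: "c * (1 + c') = (1 + c') * c" by (simp add: algebra_simps cc)
    have cc3: "(1 + c') ^ m * c = c * (1 + c') ^ m" for m
      by (rule power_commuting_commutes) (rule cc2[symmetric])
    have step: "positive (c * c' * (1 + c') ^ n - c * c')"
    proof -
      have one: "positive ((1 + c') ^ m - 1)" for m
      proof (induction m)
        case (Suc m)
        have "(1 + c') ^ Suc m - 1 = ((1 + c') ^ m - 1) + c' * (1 + c') ^ m"
          by (simp add: algebra_simps)
        moreover have "positive (c' * (1 + c') ^ m)"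
          by (rule positive_mult_commuting)
            (use c' in \<open>auto intro!: positive_power positive_add power_commuting_commutes[symmetric]
              simp: algebra_simps\<close>)
        ultimately show ?case using positive_add[OF Suc] by metis
      qed simp
      have "c * c' * (1 + c') ^ n - c * c' = (c * c') * ((1 + c') ^ n - 1)"
        by (simp add: algebra_simps)
      moreover have "(1 + c') ^ n * c' = c' * (1 + c') ^ n"
        by (rule power_commuting_commutes) (simp add: algebra_simps)
      ultimately show ?thesis
        using positive_mult_commuting[OF positive_mult_commuting[OF c c' cc] one]
        by (metis (no_types, lifting) cc3 left_diff_distrib mult.assoc mult_1 mult_1_right right_diff_distrib)
    qed
    have "c * (1 + c') ^ Suc n - of_nat (Suc n) *\<^sub>R (c * c')
      = (c * (1 + c') ^ n - of_nat n *\<^sub>R (c * c')) + (c * c' * (1 + c') ^ n - c * c')"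
      by (simp add: algebra_simps)
    then show ?case using positive_add[OF Suc step] by simp
  qed
  have "real n * norm (c * c') \<le> (norm y)\<^sup>2" for n
  proof -
    have "positive (of_nat n *\<^sub>R (c * c'))"
      by (intro positive_scaleR positive_mult_commuting c c') (auto simp: c'_def)
    from norm_mono_positive[OF this lower[of n]] bound[of n] show ?thesis by simp
  qed
  moreover have "norm (c * c') > 0"
  proof -
    have "norm (c * c) = (norm c)\<^sup>2" by (intro norm_selfadjoint_square positive_selfadjoint c)
    moreover have "c \<noteq> 0" using nz by (simp add: c_def)
    ultimately show ?thesis using \<open>r > 0\<close> by (auto simp: c'_def)
  qed
  ultimately show False
    using ex_less_of_nat_mult[of "norm (c * c')" "(norm y)\<^sup>2"] by (metis linorder_not_le)
qed

lemma positive_star_mult: "positive (star x * (x :: 'a::cstar_algebra_1))"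
proof -
  define a where "a = star x * x"
  have a: "star a = a" by (simp add: a_def star_mult star_star)
  obtain m where m: "positive m" "m * m = a * a" "\<forall>y. y * (a * a) = (a * a) * y \<longrightarrow> y * m = m * y"
    using positive_square_root[OF positive_square[OF a]] .
  have am: "a * m = m * a" by (rule m(3)[rule_format]) (simp add: mult.assoc)
  \<comment> \<open>A second root, so that \<open>n * m * n\<close> can be displayed as the square
    of the self-adjoint \<open>q * n\<close>.\<close>
  obtain q where q: "positive q" "q * q = m" "\<forall>y. y * m = m * y \<longrightarrow> y * q = q * y"
    using positive_square_root[OF m(1)] .
  \<comment> \<open>\<open>m\<close> is the absolute value of \<open>a\<close>, so \<open>n\<close>
    is its negative part, and \<open>n * n = m * n\<close> expresses that it is orthogonal to the
    positive part \<open>m - n\<close>. Cutting \<open>x\<close> down to \<open>x * n\<close>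
    isolates the part where \<open>a\<close> is negative, and the previous lemma kills it.\<close>
  define n where "n = (1/2) *\<^sub>R (m - a)"
  have n: "star n = n" by (simp add: n_def star_scaleR star_diff a m(1) positive_selfadjoint)
  have nm: "n * m = m * n" by (simp add: n_def algebra_simps am)
  have nq: "n * q = q * n" by (rule q(3)[rule_format]) (simp add: nm)
  have nn: "n * n = m * n"
    by (simp add: n_def algebra_simps am m(2) flip: scaleR_2)
  have na: "a = m - 2 *\<^sub>R n" by (simp add: n_def)
  have "a * n = - (m * n)"
    by (simp add: na algebra_simps nn scaleR_2)
  have "star (x * n) * (x * n) = n * (a * n)"
    by (simp add: star_mult n a_def mult.assoc)
  also have "\<dots> = - ((q * n) * (q * n))"
    by (metis \<open>a * n = - (m * n)\<close> mult.assoc mult_minus_right nq q(2))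
  finally have e: "star (x * n) * (x * n) = - ((q * n) * (q * n))" .
  have qn: "star (q * n) = q * n" by (simp add: star_mult n positive_selfadjoint q(1) nq)
  have "star (x * n) * (x * n) = 0"
    by (rule negative_star_mult_imp_zero) (simp add: e positive_square qn)
  then have "q * n = 0" using e norm_selfadjoint_square[OF qn] by simp
  then have "m * n = 0" by (metis mult.assoc mult_zero_right q(2))
  then have "n = 0" using nn norm_selfadjoint_square[OF n] by simp
  then have "a = m" by (simp add: na)
  then show ?thesis using m(1) by (simp add: a_def)
qed

lemma positive_conjugate:
  assumes "positive a" shows "positive (star c * a * c)"
proof -
  obtain b where b: "star b = b" "a = b * b" using assms by (rule positiveE)
  have "star c * a * c = star (b * c) * (b * c)" by (simp add: b star_mult mult.assoc)
  then show ?thesis using positive_star_mult by metis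
qed

section \<open>The unitization\<close>

datatype 'a unitization = Unitization (scalar_part: complex) (algebra_part: 'a)

instantiation unitization :: (cstar_algebra) "{zero, one, plus, minus, uminus, times, scaleR, scaleC}"
begin
definition "0 = Unitization 0 0"
definition "1 = Unitization 1 0"
definition "x + y = Unitization (scalar_part x + scalar_part y) (algebra_part x + algebra_part y)"
definition "x - y = Unitization (scalar_part x - scalar_part y) (algebra_part x - algebra_part y)"
definition "- x = Unitization (- scalar_part x) (- algebra_part x)"
definition "x * y = Unitization (scalar_part x * scalar_part y)
  (scalar_part x *\<^sub>C algebra_part y + scalar_part y *\<^sub>C algebra_part x + algebra_part x * algebra_part y)"
definition "r *\<^sub>R x = Unitization (r *\<^sub>R scalar_part x) (r *\<^sub>R algebra_part x)"
definition "c *\<^sub>C x = Unitization (c * scalar_part x) (c *\<^sub>C algebra_part x)"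
instance ..
end

lemmas unitization_defs = zero_unitization_def one_unitization_def plus_unitization_def
  minus_unitization_def uminus_unitization_def times_unitization_def scaleR_unitization_def
  scaleC_unitization_def

definition left_multiplication :: "'a::cstar_algebra unitization \<Rightarrow> 'a \<Rightarrow> 'a" where
  "left_multiplication x b = scalar_part x *\<^sub>C b + algebra_part x * b"

lemma bounded_linear_left_multiplication: "bounded_linear (left_multiplication x)"
  unfolding left_multiplication_def
  by (intro bounded_linear_add bounded_linear_scaleC bounded_linear_mult_right)

lemma norm_left_multiplication:
  "norm (left_multiplication x b) \<le> onorm (left_multiplication x) * norm b"
  by (rule onorm[OF bounded_linear_left_multiplication])

lemma left_multiplication_plus:
  "left_multiplication (x + y) = (\<lambda>b. left_multiplication x b + left_multiplication y b)"
  by (auto simp: left_multiplication_def unitization_defs scaleC_add_left algebra_simps)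

lemma left_multiplication_times:
  "left_multiplication (x * y) = left_multiplication x \<circ> left_multiplication y"
  by (auto simp: left_multiplication_def unitization_defs scaleC_add_right scaleC_scaleC
      scaleC_mult_left scaleC_mult_right algebra_simps)

lemma left_multiplication_scaleC:
  "left_multiplication (c *\<^sub>C x) = (\<lambda>b. c *\<^sub>C left_multiplication x b)"
  by (auto simp: left_multiplication_def unitization_defs scaleC_add_right scaleC_scaleC
      scaleC_mult_left)

lemma left_multiplication_scaleR:
  "left_multiplication (r *\<^sub>R x) = (\<lambda>b. r *\<^sub>R left_multiplication x b)"
  by (rule ext) (simp add: left_multiplication_def unitization_defs scaleR_scaleC scaleC_add_right
      scaleC_scaleC scaleC_mult_left scaleC_complex_def)

lemma onorm_scaleC:
  assumes "bounded_linear (f :: 'a::real_normed_vector \<Rightarrow> 'b::complex_normed_vector)"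
  shows "onorm (\<lambda>x. c *\<^sub>C f x) = cmod c * onorm f"
proof -
  have "onorm (\<lambda>x. c *\<^sub>C f x) = onorm (\<lambda>x. cmod c *\<^sub>R f x)"
    by (simp add: onorm_def norm_scaleC)
  then show ?thesis by (simp add: onorm_scaleR[OF assms])
qed

text \<open>Testing the operator on \<open>star a\<close> attains the norm, by the
  C*-identity.\<close>

lemma onorm_left_multiplication_algebra:
  "onorm (left_multiplication (Unitization 0 a)) = norm a"
proof (rule antisym)
  show "onorm (left_multiplication (Unitization 0 a)) \<le> norm a"
    by (rule onorm_bound) (auto simp: left_multiplication_def norm_mult_ineq)
  have "norm a * norm a \<le> onorm (left_multiplication (Unitization 0 a)) * norm a"
    using norm_left_multiplication[of "Unitization 0 a" "star a"]
    by (simp add: left_multiplication_def norm_star_mult norm_star power2_eq_square)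
  then show "norm a \<le> onorm (left_multiplication (Unitization 0 a))"
    by (cases "a = 0") (auto simp: onorm_pos_le bounded_linear_left_multiplication)
qed

text \<open>If \<open>'a\<close> has a unit, the operator norm is only a seminorm on the unitization, hence the maximum.\<close>

instantiation unitization :: (cstar_algebra) "{complex_normed_vector, real_normed_algebra}"
begin

definition "norm x = max (cmod (scalar_part x)) (onorm (left_multiplication x))"
definition "dist x y = norm (x - y)" for x y :: "'a unitization"
definition "sgn x = inverse (norm x) *\<^sub>R x" for x :: "'a unitization"
definition "(uniformity :: ('a unitization \<times> 'a unitization) filter) =
  (INF e\<in>{0 <..}. principal {(x, y). dist x y < e})"
definition "open S \<longleftrightarrow> (\<forall>x\<in>S. \<forall>\<^sub>F (x', y) in uniformity. x' = x \<longrightarrow> y \<in> S)"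
  for S :: "'a unitization set"

lemma norm_unitization_le: "norm (x :: 'a unitization) \<le> cmod (scalar_part x) + norm (algebra_part x)"
proof -
  have "norm (left_multiplication x b) \<le> (cmod (scalar_part x) + norm (algebra_part x)) * norm b" for b
    unfolding left_multiplication_def
    by (rule norm_triangle_le)
      (simp add: norm_scaleC norm_mult_ineq distrib_right)
  then have "onorm (left_multiplication x) \<le> cmod (scalar_part x) + norm (algebra_part x)"
    by (intro onorm_bound) auto
  then show ?thesis by (simp add: norm_unitization_def)
qed

lemma norm_unitization_algebra [simp]: "norm (Unitization 0 a :: 'a unitization) = norm a"
  by (simp add: norm_unitization_def onorm_left_multiplication_algebra)

lemma norm_scalar_part_le: "cmod (scalar_part x) \<le> norm (x :: 'a unitization)"
  by (simp add: norm_unitization_def)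

lemma unitization_triangle: "norm (x + y) \<le> norm x + norm (y :: 'a unitization)"
  using onorm_triangle[OF bounded_linear_left_multiplication bounded_linear_left_multiplication, of x y]
    norm_triangle_ineq[of "scalar_part x" "scalar_part y"]
  unfolding norm_unitization_def left_multiplication_plus
  by (auto simp: plus_unitization_def max_def)

text \<open>One unit of the factor 2 pays for subtracting the scalar part. Both coordinates are thus
  continuous, which gives definiteness of the norm and completeness.\<close>

lemma norm_algebra_part_le: "norm (algebra_part x) \<le> 2 * norm (x :: 'a unitization)"
proof -
  have "Unitization 0 (algebra_part x) = x + Unitization (- scalar_part x) 0"
    by (simp add: unitization_defs)
  then have "norm (algebra_part x) = norm (x + Unitization (- scalar_part x) 0)"
    by (metis norm_unitization_algebra)
  also have "\<dots> \<le> norm x + cmod (scalar_part x)"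
    using unitization_triangle[of x "Unitization (- scalar_part x) 0"]
      norm_unitization_le[of "Unitization (- scalar_part x) 0"] by simp
  finally show ?thesis using norm_scalar_part_le[of x] by simp
qed

lemma onorm_left_multiplication_times:
  "onorm (left_multiplication (x * y)) \<le> onorm (left_multiplication x) * onorm (left_multiplication y)"
  unfolding left_multiplication_times
  by (intro onorm_compose bounded_linear_left_multiplication)

instance
proof
  fix x y z :: "'a unitization" and r s :: real and c d :: complex
  show "x + y + z = x + (y + z)" "x + y = y + x" "0 + x = x" "- x + x = 0" "x - y = x + - y"
    "r *\<^sub>R (x + y) = r *\<^sub>R x + r *\<^sub>R y" "(r + s) *\<^sub>R x = r *\<^sub>R x + s *\<^sub>R x"
    "r *\<^sub>R s *\<^sub>R x = (r * s) *\<^sub>R x" "1 *\<^sub>R x = x"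
    "r *\<^sub>R x = complex_of_real r *\<^sub>C x"
    "c *\<^sub>C (x + y) = c *\<^sub>C x + c *\<^sub>C y" "(c + d) *\<^sub>C x = c *\<^sub>C x + d *\<^sub>C x"
    "c *\<^sub>C d *\<^sub>C x = (c * d) *\<^sub>C x"
    by (simp_all add: unitization_defs scaleC_add_left
        scaleC_add_right scaleC_scaleC scaleR_scaleC algebra_simps scaleC_complex_def)
  show "x * y * z = x * (y * z)" "(x + y) * z = x * z + y * z" "x * (y + z) = x * y + x * z"
    "r *\<^sub>R x * y = r *\<^sub>R (x * y)" "x * r *\<^sub>R y = r *\<^sub>R (x * y)"
    by (simp_all add: unitization_defs scaleC_add_left scaleC_add_right scaleC_scaleC
        scaleR_scaleC algebra_simps scaleC_complex_def scaleC_mult_left scaleC_mult_right)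
  show "dist x y = norm (x - y)" "sgn x = inverse (norm x) *\<^sub>R x"
    "(uniformity :: ('a unitization \<times> 'a unitization) filter) =
      (INF e\<in>{0 <..}. principal {(x, y). dist x y < e})"
    by (rule dist_unitization_def sgn_unitization_def uniformity_unitization_def)+
  show "open U = (\<forall>x\<in>U. \<forall>\<^sub>F (x', y) in uniformity. x' = x \<longrightarrow> y \<in> U)" for U :: "'a unitization set"
    by (rule open_unitization_def)
  show "(norm x = 0) = (x = 0)"
  proof
    assume x: "norm x = 0"
    show "x = 0" using norm_scalar_part_le[of x] norm_algebra_part_le[of x] x
      by (simp add: unitization.expand unitization_defs)
  next
    assume "x = 0"
    then have "x = Unitization 0 0" by (simp add: unitization_defs)
    then show "norm x = 0" by simp
  qed
  show "norm (x + y) \<le> norm x + norm y" by (rule unitization_triangle)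
  have "scalar_part (r *\<^sub>R x) = r *\<^sub>R scalar_part x" by (simp add: scaleR_unitization_def)
  then show "norm (r *\<^sub>R x) = \<bar>r\<bar> * norm x"
    by (simp add: norm_unitization_def left_multiplication_scaleR max_mult_distrib_left
        onorm_scaleR[OF bounded_linear_left_multiplication])
  have "scalar_part (c *\<^sub>C x) = c * scalar_part x" by (simp add: scaleC_unitization_def)
  then show "norm (c *\<^sub>C x) = cmod c * norm x"
    by (simp add: norm_unitization_def left_multiplication_scaleC max_mult_distrib_left
        onorm_scaleC[OF bounded_linear_left_multiplication] norm_mult)
  show "norm (x * y) \<le> norm x * norm y"
  proof -
    have "onorm (left_multiplication x) * onorm (left_multiplication y) \<le> norm x * norm y"
      by (intro mult_mono) (auto simp: norm_unitization_def le_max_iff_disj onorm_pos_le bounded_linear_left_multiplication)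
    with onorm_left_multiplication_times[of x y] norm_scalar_part_le[of x] norm_scalar_part_le[of y]
    show ?thesis
      unfolding norm_unitization_def[of "x * y"]
      by (auto simp: times_unitization_def norm_mult intro!: mult_mono order_trans[OF norm_ge_zero norm_scalar_part_le])
  qed
qed

end

instance unitization :: (cstar_algebra) banach
proof
  fix X :: "nat \<Rightarrow> 'a unitization"
  assume "Cauchy X"
  then have X: "\<exists>M. \<forall>m\<ge>M. \<forall>n\<ge>M. norm (X m - X n) < e" if "e > 0" for e
    using that by (simp add: Cauchy_def dist_unitization_def)
  have "Cauchy (\<lambda>n. scalar_part (X n))"
  proof (rule metric_CauchyI)
    fix e :: real assume "e > 0"
    from X[OF this] obtain M where M: "\<forall>m\<ge>M. \<forall>n\<ge>M. norm (X m - X n) < e" by blast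
    have "dist (scalar_part (X m)) (scalar_part (X n)) \<le> norm (X m - X n)" for m n
      using norm_scalar_part_le[of "X m - X n"] by (simp add: dist_norm minus_unitization_def)
    with M show "\<exists>M. \<forall>m\<ge>M. \<forall>n\<ge>M. dist (scalar_part (X m)) (scalar_part (X n)) < e"
      by (meson order_le_less_trans)
  qed
  then obtain c where c: "(\<lambda>n. scalar_part (X n)) \<longlonglongrightarrow> c"
    using Cauchy_convergent unfolding convergent_def by blast
  have "Cauchy (\<lambda>n. algebra_part (X n))"
  proof (rule metric_CauchyI)
    fix e :: real assume "e > 0"
    with X[of "e/2"] obtain M where M: "\<forall>m\<ge>M. \<forall>n\<ge>M. norm (X m - X n) < e / 2" by auto
    have "dist (algebra_part (X m)) (algebra_part (X n)) < e" if "norm (X m - X n) < e / 2" for m n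
      using norm_algebra_part_le[of "X m - X n"] that by (simp add: dist_norm minus_unitization_def)
    with M show "\<exists>M. \<forall>m\<ge>M. \<forall>n\<ge>M. dist (algebra_part (X m)) (algebra_part (X n)) < e"
      by blast
  qed
  then obtain a where a: "(\<lambda>n. algebra_part (X n)) \<longlonglongrightarrow> a"
    using Cauchy_convergent unfolding convergent_def by blast
  have "(\<lambda>n. cmod (scalar_part (X n) - c) + norm (algebra_part (X n) - a)) \<longlonglongrightarrow> 0 + 0"
    by (intro tendsto_add tendsto_norm_zero LIM_zero c a)
  then have lim: "(\<lambda>n. cmod (scalar_part (X n) - c) + norm (algebra_part (X n) - a)) \<longlonglongrightarrow> 0"
    by simp
  have "X \<longlonglongrightarrow> Unitization c a"
    unfolding tendsto_iff
  proof (intro allI impI)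
    fix e :: real assume "e > 0"
    with lim have "\<forall>\<^sub>F n in sequentially. cmod (scalar_part (X n) - c) + norm (algebra_part (X n) - a) < e"
      by (rule order_tendstoD)
    then show "\<forall>\<^sub>F n in sequentially. dist (X n) (Unitization c a) < e"
      by eventually_elim
        (use norm_unitization_le[of "_ - Unitization c a"] in
          \<open>auto simp: dist_unitization_def minus_unitization_def intro: le_less_trans\<close>)
  qed
  then show "convergent X" by (auto simp: convergent_def)
qed

instantiation unitization :: (cstar_algebra) cstar_algebra
begin

definition "star x = Unitization (cnj (scalar_part x)) (star (algebra_part x))"

text \<open>The C*-identity of the original algebra, applied to the vector
  \<open>left_multiplication x b\<close>, is carried over to the operator norm.\<close>

lemma onorm_left_multiplication_le_star:
  "(onorm (left_multiplication x))\<^sup>2 \<le> onorm (left_multiplication (star x * x))"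
proof -
  let ?K = "onorm (left_multiplication (star x * x))"
  have K: "?K \<ge> 0" by (rule onorm_pos_le[OF bounded_linear_left_multiplication])
  have "norm (left_multiplication x b) \<le> sqrt ?K * norm b" for b
  proof -
    have "star (left_multiplication x b) * left_multiplication x b
        = star b * left_multiplication (star x * x) b"
      by (simp add: left_multiplication_def unitization_defs star_unitization_def star_add
          star_scaleC star_mult scaleC_mult_left scaleC_mult_right scaleC_add_right scaleC_scaleC
          algebra_simps)
    then have "(norm (left_multiplication x b))\<^sup>2 = norm (star b * left_multiplication (star x * x) b)"
      using cstar_identity[of "left_multiplication x b"] by simp
    also have "\<dots> \<le> norm (star b) * norm (left_multiplication (star x * x) b)"
      by (rule norm_mult_ineq)
    also have "\<dots> \<le> norm b * (?K * norm b)"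
      unfolding norm_star by (intro mult_left_mono norm_left_multiplication norm_ge_zero)
    also have "\<dots> = (sqrt ?K * norm b)\<^sup>2" using K by (simp add: power2_eq_square)
    finally show ?thesis by (rule power2_le_imp_le) (simp add: K)
  qed
  then have "onorm (left_multiplication x) \<le> sqrt ?K"
    using K by (intro onorm_bound) auto
  then have "(onorm (left_multiplication x))\<^sup>2 \<le> (sqrt ?K)\<^sup>2"
    by (intro power_mono onorm_pos_le bounded_linear_left_multiplication)
  then show ?thesis using K by simp
qed

lemma onorm_left_multiplication_star:
  "onorm (left_multiplication (star x)) = onorm (left_multiplication x)"
proof -
  have le: "onorm (left_multiplication y) \<le> onorm (left_multiplication (star y))" for y :: "'a unitization"
  proof (cases "onorm (left_multiplication y) = 0")
    case False
    then have "onorm (left_multiplication y) > 0"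
      using onorm_pos_le[OF bounded_linear_left_multiplication, of y] by linarith
    moreover have "onorm (left_multiplication y) * onorm (left_multiplication y)
        \<le> onorm (left_multiplication (star y)) * onorm (left_multiplication y)"
      using onorm_left_multiplication_le_star[of y] onorm_left_multiplication_times[of "star y" y]
      by (simp add: power2_eq_square)
    ultimately show ?thesis by simp
  qed (simp add: onorm_pos_le bounded_linear_left_multiplication)
  have "star (star x) = x" by (simp add: star_unitization_def star_star)
  with le[of x] le[of "star x"] show ?thesis by simp
qed

instance
proof
  fix x y :: "'a unitization" and c :: complex
  show "c *\<^sub>C x * y = c *\<^sub>C (x * y)" "x * c *\<^sub>C y = c *\<^sub>C (x * y)"
    by (simp_all add: unitization_defs scaleC_add_right scaleC_scaleC algebra_simps
        scaleC_mult_left scaleC_mult_right)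
  show "star (x + y) = star x + star y" "star (c *\<^sub>C x) = cnj c *\<^sub>C star x"
    "star (x * y) = star y * star x" "star (star x) = x"
    by (simp_all add: unitization_defs star_unitization_def star_add star_scaleC star_mult star_star
        algebra_simps)
  show "norm (star x * x) = (norm x)\<^sup>2"
  proof -
    have "onorm (left_multiplication (star x * x)) = (onorm (left_multiplication x))\<^sup>2"
      using onorm_left_multiplication_le_star[of x] onorm_left_multiplication_times[of "star x" x]
      by (simp add: onorm_left_multiplication_star power2_eq_square)
    moreover have "max (a\<^sup>2) (b\<^sup>2) = (max a b)\<^sup>2" if "a \<ge> 0" "b \<ge> 0" for a b :: real
      using that by (auto simp: max_def power_mono intro: antisym)
    ultimately show ?thesis
      by (simp add: norm_unitization_def onorm_pos_le bounded_linear_left_multiplication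
          times_unitization_def star_unitization_def norm_mult power2_eq_square)
  qed
qed

end

instance unitization :: (cstar_algebra) cstar_algebra_1
proof
  fix x :: "'a unitization"
  show "1 * x = x" "x * 1 = x" "(0::'a unitization) \<noteq> 1" by (simp_all add: unitization_defs)
  have "onorm (left_multiplication 1 :: 'a \<Rightarrow> 'a) \<le> 1"
    by (rule onorm_bound) (auto simp: left_multiplication_def unitization_defs)
  then show "norm (1 :: 'a unitization) = 1"
    by (simp add: norm_unitization_def unitization_defs max_def)
qed

definition emb :: "'a::cstar_algebra \<Rightarrow> 'a unitization" where
  "emb a = Unitization 0 a"

lemma norm_emb [simp]: "norm (emb a) = norm a"
  by (simp add: emb_def)

lemma emb_add: "emb (a + b) = emb a + emb b"
  and emb_diff: "emb (a - b) = emb a - emb b"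
  and emb_minus: "emb (- a) = - emb a"
  and emb_mult: "emb (a * b) = emb a * emb b"
  and emb_scaleR: "emb (r *\<^sub>R a) = r *\<^sub>R emb a"
  and emb_scaleC: "emb (c *\<^sub>C a) = c *\<^sub>C emb a"
  and emb_star: "emb (star a) = star (emb a)"
  and emb_zero: "emb 0 = 0"
  by (simp_all add: emb_def unitization_defs star_unitization_def)

lemmas emb_simps = emb_add emb_diff emb_minus emb_mult emb_scaleR emb_scaleC emb_star

lemma emb_sum: "emb (sum f A) = (\<Sum>i\<in>A. emb (f i))"
  by (induction A rule: infinite_finite_induct) (auto simp: emb_add emb_zero)

lemma emb_eq_iff: "emb a = emb b \<longleftrightarrow> a = b"
  by (simp add: emb_def)

lemma scalar_part_emb: "scalar_part (emb a) = 0"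
  by (simp add: emb_def)

lemma emb_algebra_part: "scalar_part x = 0 \<Longrightarrow> emb (algebra_part x) = x"
  by (simp add: emb_def unitization.expand)

lemma scalar_part_times: "scalar_part (x * y) = scalar_part x * scalar_part y"
  and scalar_part_minus: "scalar_part (x - y) = scalar_part x - scalar_part y"
  and scalar_part_one: "scalar_part 1 = 1"
  by (simp_all add: unitization_defs)

section \<open>Approximate units\<close>

lemma one_minus_power_eq:
  "1 - (1 - t) ^ n = (\<Sum>k<n. t * (1 - t) ^ k)" for t :: "'a::ring_1"
  by (induction n) (auto simp: algebra_simps)

lemma positive_times_power:
  assumes "positive t" "positive (1 - t)" shows "positive (t * (1 - t) ^ n)"
proof (rule positive_mult_commuting)
  show "t * (1 - t) ^ n = (1 - t) ^ n * t"
    by (rule power_commuting_commutes[symmetric]) (simp add: algebra_simps)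
qed (use assms positive_power in auto)

lemma positive_one_minus_power:
  assumes "positive t" "positive (1 - t)" shows "positive (1 - (1 - t) ^ n)"
  unfolding one_minus_power_eq by (intro positive_sum positive_times_power assms)

text \<open>The \<open>n + 1\<close> elements \<open>t w^k\<close> with \<open>k \<le> n\<close> all
  dominate \<open>t w^n\<close>, and they sum to \<open>1 - w^(n+1)\<close>, which is at most
  1.\<close>

lemma norm_times_power_le:
  assumes t: "positive t" "positive (1 - t)"
  shows "norm (t * (1 - t) ^ n) \<le> 1 / real (Suc n)"
proof -
  define w where "w = 1 - t"
  have "positive (t * w ^ k - t * w ^ n)" if "k \<le> n" for k
  proof -
    have n: "w ^ n = w ^ k * w ^ (n - k)" using that by (simp flip: power_add)
    have "t * w ^ k * (1 - w ^ (n - k)) = (1 - w ^ (n - k)) * (t * w ^ k)"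
    proof -
      have tw: "w ^ i * t = t * w ^ i" for i
        by (rule power_commuting_commutes) (simp add: w_def algebra_simps)
      have "t * w ^ k * w ^ (n - k) = w ^ (n - k) * (t * w ^ k)"
        by (metis tw mult.assoc power_add add.commute)
      then show ?thesis by (simp add: algebra_simps)
    qed
    then have "positive (t * w ^ k * (1 - w ^ (n - k)))"
      unfolding w_def
      by (intro positive_mult_commuting positive_times_power positive_one_minus_power t)
    moreover have "t * w ^ k - t * w ^ n = t * w ^ k * (1 - w ^ (n - k))"
      by (simp add: n algebra_simps)
    ultimately show ?thesis by simp
  qed
  then have "positive (\<Sum>k<Suc n. t * w ^ k - t * w ^ n)"
    by (intro positive_sum) auto
  moreover have "(\<Sum>k<Suc n. t * w ^ k - t * w ^ n) = (1 - w ^ Suc n) - real (Suc n) *\<^sub>R (t * w ^ n)"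
    unfolding w_def one_minus_power_eq sum_subtractf
    by (simp only: sum_constant card_lessThan) (simp add: scaleR_conv_of_real)
  moreover have "positive (w ^ Suc n)" unfolding w_def by (intro positive_power t)
  ultimately have "positive (1 - real (Suc n) *\<^sub>R (t * w ^ n))"
    using positive_add[of "w ^ Suc n" "(1 - w ^ Suc n) - real (Suc n) *\<^sub>R (t * w ^ n)"] by simp
  then have "norm (real (Suc n) *\<^sub>R (t * w ^ n)) \<le> 1"
    unfolding w_def by (intro norm_le_of_positive_diff_1 positive_scaleR positive_times_power t) auto
  then show ?thesis unfolding w_def by (simp add: divide_simps mult.commute)
qed

text \<open>Positivity is read in the unitization, where the order is available.\<close>

definition positive_contraction :: "'a::cstar_algebra \<Rightarrow> bool" where
  "positive_contraction e \<longleftrightarrow> positive (emb e) \<and> positive (1 - emb e)"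

lemma positive_contraction_norm: "positive_contraction e \<Longrightarrow> norm e \<le> 1"
  using norm_le_of_positive_diff_1[of "emb e"] by (simp add: positive_contraction_def)

lemma positive_contraction_star: "positive_contraction e \<Longrightarrow> star e = e"
  using positive_selfadjoint[of "emb e"]
  by (simp add: positive_contraction_def emb_eq_iff flip: emb_star)

lemma ex_approximate_unit:
  fixes S :: "'a::cstar_algebra set"
  assumes "finite S" "\<epsilon> > 0"
  shows "\<exists>e. positive_contraction e \<and> (\<forall>a\<in>S. norm (a * e - a) < \<epsilon> \<and> norm (e * a - a) < \<epsilon>)"
proof -
  \<comment> \<open>\<open>h\<close> dominates \<open>a* a\<close> and \<open>a a*\<close> for all
    \<open>a\<close> in \<open>S\<close> at once; the second summand handles left multiplication by
    \<open>e\<close> through \<open>star a\<close>. For \<open>e = 1 - (1 - h / r)^n\<close> the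
    squared error is at most the norm of \<open>w^n h w^n\<close>, hence at most
    \<open>r / (2 n + 1)\<close>.\<close>
  define h where "h = (\<Sum>a\<in>S. star a * a + a * star a)"
  define r where "r = norm h + 1"
  have r: "r > 0" by (simp add: r_def add_nonneg_pos)
  have pos1: "positive (emb (star b * b))" for b :: 'a
    by (simp add: emb_simps positive_star_mult)
  have pos2: "positive (emb (b * star b))" for b :: 'a
    using pos1[of "star b"] by (simp add: star_star)
  have h_pos: "positive (emb h)"
    unfolding h_def emb_sum emb_add by (intro positive_sum positive_add pos1 pos2)
  define t where "t = emb ((1 / r) *\<^sub>R h)"
  define w where "w = 1 - t"
  have t: "positive t" unfolding t_def emb_scaleR using r h_pos by (intro positive_scaleR) auto
  have "w = (1/r) *\<^sub>R (of_real r - emb h)"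
    using r by (simp add: w_def t_def emb_scaleR of_real_def scaleR_diff_right)
  moreover have "positive (of_real r - emb h)"
    by (rule positive_of_real_diff) (auto simp: positive_selfadjoint h_pos r_def)
  ultimately have w: "positive w" using r by (simp add: positive_scaleR)
  obtain n :: nat where n: "r / \<epsilon>\<^sup>2 < real n" using reals_Archimedean2 by blast
  define e where "e = algebra_part (1 - w ^ n)"
  \<comment> \<open>Hence \<open>1 - w ^ n\<close> has scalar part 0 and comes from the algebra
    itself.\<close>
  have "scalar_part (w ^ n) = 1" for n
    by (induction n) (auto simp: scalar_part_one scalar_part_times w_def t_def scalar_part_minus scalar_part_emb)
  then have e: "emb e = 1 - w ^ n"
    unfolding e_def by (intro emb_algebra_part) (simp add: scalar_part_minus scalar_part_one)
  have pc: "positive_contraction e"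
    unfolding positive_contraction_def e
    using positive_one_minus_power[OF t, of n] w positive_power[OF w, of n] by (simp add: w_def)
  have key: "norm (b * e - b) < \<epsilon>" if b: "positive (emb h - emb (star b * b))" for b
  proof -
    have "emb (b * e - b) = - (emb b * w ^ n)" by (simp add: emb_simps e algebra_simps)
    then have "(norm (b * e - b))\<^sup>2 = (norm (emb b * w ^ n))\<^sup>2"
      by (metis norm_emb norm_minus_cancel)
    also have "\<dots> = norm (w ^ n * emb (star b * b) * w ^ n)"
      by (simp add: star_mult star_power positive_selfadjoint[OF w] emb_simps mult.assoc
          flip: cstar_identity)
    also have "\<dots> \<le> norm (w ^ n * emb h * w ^ n)"
    proof (rule norm_mono_positive)
      have *: "positive (w ^ n * x * w ^ n)" if "positive x" for x
        using positive_conjugate[OF that, of "w ^ n"] by (simp add: star_power positive_selfadjoint[OF w])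
      show "positive (w ^ n * emb (star b * b) * w ^ n)" by (rule *[OF pos1])
      show "positive (w ^ n * emb h * w ^ n - w ^ n * emb (star b * b) * w ^ n)"
        using *[OF b] by (simp add: algebra_simps)
    qed
    also have "w ^ n * emb h * w ^ n = r *\<^sub>R (t * (1 - t) ^ (2 * n))"
    proof -
      have "w ^ n * t = t * w ^ n"
        by (rule power_commuting_commutes) (simp add: w_def algebra_simps)
      then have "w ^ n * t * w ^ n = t * w ^ (2 * n)"
        by (simp add: mult.assoc mult_2 power_add)
      moreover have "emb h = r *\<^sub>R t" using r by (simp add: t_def emb_scaleR)
      ultimately show ?thesis by (simp add: w_def)
    qed
    also have "norm \<dots> \<le> r * (1 / real (Suc (2 * n)))"
      using mult_left_mono[OF norm_times_power_le[OF t, of "2 * n"], of r] w r by (simp add: w_def)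
    also have "\<dots> < \<epsilon>\<^sup>2"
    proof -
      have "r < real n * \<epsilon>\<^sup>2" using n assms(2) by (simp add: pos_divide_less_eq)
      also have "\<dots> \<le> real (Suc (2 * n)) * \<epsilon>\<^sup>2" by (intro mult_right_mono) auto
      finally show ?thesis by (simp add: divide_simps mult.commute)
    qed
    finally show ?thesis using assms(2) by (simp add: power_less_imp_less_base)
  qed
  have "norm (a * e - a) < \<epsilon> \<and> norm (e * a - a) < \<epsilon>" if a: "a \<in> S" for a
  proof
    have h: "h = star a * a + a * star a + (\<Sum>a\<in>S - {a}. star a * a + a * star a)"
      unfolding h_def by (rule sum.remove[OF assms(1) a])
    have rest: "positive (emb (\<Sum>a\<in>S - {a}. star a * a + a * star a))"
      unfolding emb_sum emb_add by (intro positive_sum positive_add pos1 pos2)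
    have "emb h - emb (star a * a) = emb (a * star a) + emb (\<Sum>a\<in>S - {a}. star a * a + a * star a)"
      by (subst h) (simp add: emb_add)
    then show "norm (a * e - a) < \<epsilon>"
      by (intro key) (simp only: positive_add[OF pos2 rest])
    have "emb h - emb (star (star a) * star a)
        = emb (star a * a) + emb (\<Sum>a\<in>S - {a}. star a * a + a * star a)"
      by (subst h) (simp add: emb_add star_star)
    then have "norm (star a * e - star a) < \<epsilon>"
      by (intro key) (simp only: positive_add[OF pos1 rest])
    then have "norm (star (star a * e - star a)) < \<epsilon>" by (simp only: norm_star)
    then show "norm (e * a - a) < \<epsilon>"
      by (simp add: star_diff star_mult star_star positive_contraction_star[OF pc])
  qed
  with pc show ?thesis by blast
qed

text \<open>A filter on the algebra takes the place of an approximate unit indexed by a directed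
  set: its members are their own indices, and only the finite intersection property has to be
  proved.\<close>

definition approximate_units :: "'a::cstar_algebra filter" where
  "approximate_units = (INF (a, \<epsilon>) \<in> UNIV \<times> {0<..}. principal
     {e. positive_contraction e \<and> norm (a * e - a) < \<epsilon> \<and> norm (e * a - a) < \<epsilon>})"

lemma approximate_units_neq_bot: "approximate_units \<noteq> (bot :: 'a::cstar_algebra filter)"
  unfolding approximate_units_def
proof (rule INF_filter_not_bot)
  fix X :: "('a \<times> real) set"
  let ?F = "\<lambda>(a, \<epsilon>). {e. positive_contraction e \<and> norm (a * e - a) < \<epsilon> \<and> norm (e * a - a) < \<epsilon>}"
  assume X: "X \<subseteq> UNIV \<times> {0<..}" "finite X"
  \<comment> \<open>The inserted 1 covers the empty \<open>X\<close>.\<close>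
  define \<epsilon> where "\<epsilon> = Min (insert 1 (snd ` X))"
  have "\<epsilon> > 0" using X by (auto simp: \<epsilon>_def)
  with ex_approximate_unit[of "fst ` X" \<epsilon>] X obtain e where
    "positive_contraction e" "\<forall>a\<in>fst ` X. norm (a * e - a) < \<epsilon> \<and> norm (e * a - a) < \<epsilon>" by auto
  moreover have "\<epsilon> \<le> snd p" if "p \<in> X" for p using X that by (auto simp: \<epsilon>_def)
  ultimately have "e \<in> (\<Inter>p\<in>X. ?F p)" by fastforce
  moreover have "(INF p\<in>X. principal (?F p)) = principal (\<Inter>p\<in>X. ?F p)"
    by (rule INF_principal_finite[OF X(2)])
  ultimately show "(INF (a, \<epsilon>)\<in>X. principal
     {e. positive_contraction e \<and> norm (a * e - a) < \<epsilon> \<and> norm (e * a - a) < \<epsilon>}) \<noteq> bot"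
    by (auto simp: case_prod_unfold principal_eq_bot_iff)
qed

lemma eventually_approximate_units:
  assumes "\<epsilon> > 0"
  shows "\<forall>\<^sub>F e in approximate_units.
    positive_contraction e \<and> norm (a * e - a) < \<epsilon> \<and> norm (e * a - a) < \<epsilon>"
  unfolding approximate_units_def
  by (rule eventually_INF1[of "(a, \<epsilon>)"]) (use assms in \<open>auto simp: eventually_principal\<close>)

lemma eventually_positive_contraction: "\<forall>\<^sub>F e in approximate_units. positive_contraction e"
  using eventually_approximate_units[of 1 0] by (auto elim: eventually_mono)

lemma tendsto_mult_approximate_units:
  "((\<lambda>e. a * e) \<longlongrightarrow> a) approximate_units" "((\<lambda>e. e * a) \<longlongrightarrow> a) approximate_units"
  by (rule tendstoI, drule eventually_approximate_units[of _ a], erule eventually_mono,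
      simp add: dist_norm)+

section \<open>The second dual is nondegenerate\<close>

text \<open>A Pythagorean bound: the triangle inequality would give an error linear in
  \<open>y\<close>, too weak for the perturbation argument below. The companion \<open>D\<close>
  completes \<open>Z\<close> to the image of \<open>(X, Y)\<close> under the matrix with rows
  \<open>(E, 1 - E)\<close> and \<open>(1 - E, -E)\<close>, whose square is diagonal with both
  entries \<open>G\<close>, so the cross terms cancel.\<close>

lemma norm_convex_combination_le:
  assumes "positive_contraction e"
  shows "(norm (e * x + (y - e * y)))\<^sup>2 \<le> (norm x)\<^sup>2 + (norm y)\<^sup>2"
proof -
  define E where "E = emb e"
  have E: "positive E" "positive (1 - E)" using assms by (simp_all add: positive_contraction_def E_def)
  have sE: "star E = E" by (rule positive_selfadjoint[OF E(1)])
  define X where "X = emb x"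
  define Y where "Y = emb y"
  define G where "G = E * E + (1 - E) * (1 - E)"
  define Z where "Z = E * X + (1 - E) * Y"
  define D where "D = (1 - E) * X - E * Y"
  have G: "norm G \<le> 1"
  proof (rule norm_le_of_positive_diff_1)
    show "positive G"
      unfolding G_def by (intro positive_add positive_square sE) (simp add: star_diff sE)
    have "positive (2 *\<^sub>R (E * (1 - E)))"
      by (intro positive_scaleR positive_mult_commuting E) (auto simp: algebra_simps)
    moreover have "1 - G = 2 *\<^sub>R (E * (1 - E))" by (simp add: G_def algebra_simps scaleR_2)
    ultimately show "positive (1 - G)" by simp
  qed
  have "star Z * Z + star D * D = star X * G * X + star Y * G * Y"
    by (simp add: Z_def D_def G_def star_add star_diff star_mult sE algebra_simps)
  then have "star X * G * X + star Y * G * Y - star Z * Z = star D * D" by (simp add: algebra_simps)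
  then have "norm (star Z * Z) \<le> norm (star X * G * X + star Y * G * Y)"
    by (intro norm_mono_positive) (simp_all add: positive_star_mult)
  also have "\<dots> \<le> norm X * norm X + norm Y * norm Y"
  proof (rule norm_triangle_mono)
    have "norm (star U * G * U) \<le> norm U * norm U" for U :: "'a unitization"
    proof -
      have "norm (star U * G * U) \<le> norm (star U) * norm G * norm U"
        by (meson mult_right_mono norm_ge_zero norm_mult_ineq order_trans)
      also have "\<dots> \<le> norm (star U) * 1 * norm U"
        by (intro mult_right_mono mult_left_mono G) auto
      finally show ?thesis by (simp add: norm_star)
    qed
    then show "norm (star X * G * X) \<le> norm X * norm X" "norm (star Y * G * Y) \<le> norm Y * norm Y"
      by simp_all
  qed
  finally have "(norm Z)\<^sup>2 \<le> (norm x)\<^sup>2 + (norm y)\<^sup>2"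
    by (simp add: cstar_identity X_def Y_def power2_eq_square)
  moreover have "Z = emb (e * x + (y - e * y))"
    by (simp add: Z_def E_def X_def Y_def emb_simps algebra_simps)
  ultimately show ?thesis by simp
qed

lemma ex_unit_phase: "\<exists>c. cmod c = 1 \<and> c * z = complex_of_real (cmod z)"
proof (cases "z = 0")
  case True then show ?thesis by (intro exI[of _ 1]) auto
next
  case False
  then show ?thesis
    by (intro exI[of _ "complex_of_real (cmod z) / z"]) (auto simp: norm_divide)
qed

lemma dual_apply_diff: "dual_apply f (x - y) = dual_apply f x - dual_apply f y"
  using dual_apply_add[of f "x - y" y] by simp

lemma dual_apply_scaleR: "dual_apply f (r *\<^sub>R x) = of_real r * dual_apply f x"
  by (simp add: scaleR_scaleC dual_apply_scaleC)

lemma norm_dual_apply_le: "norm x \<le> k \<Longrightarrow> cmod (dual_apply f x) \<le> norm f * k"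
  by (rule order_trans[OF norm_dual_apply]) (simp add: mult_left_mono)

lemma ex_almost_norming:
  assumes "\<eta> > 0"
  obtains x where "norm x \<le> 1" "dual_apply f x = complex_of_real (cmod (dual_apply f x))"
    "norm f - \<eta> \<le> cmod (dual_apply f x)"
proof -
  have "\<exists>x. norm x \<le> 1 \<and> norm f - \<eta> \<le> cmod (dual_apply f x)"
  proof (rule ccontr)
    assume "\<not> ?thesis"
    then have *: "cmod (dual_apply f x) < norm f - \<eta>" if "norm x \<le> 1" for x
      using that by force
    have "cmod (dual_apply f x) \<le> (norm f - \<eta>) * norm x" for x
    proof (cases "x = 0")
      case True then show ?thesis using dual_apply_scaleC[of f 0 0] by simp
    next
      case False
      with *[of "(1 / norm x) *\<^sub>R x"] show ?thesis
        by (simp add: dual_apply_scaleR norm_mult norm_divide divide_simps split: if_splits)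
    qed
    moreover have "0 \<le> norm f - \<eta>" using *[of 0] by (simp, smt (verit) norm_ge_zero)
    ultimately have "norm f \<le> norm f - \<eta>" by (intro norm_dual_bound)
    with assms show False by simp
  qed
  then obtain x where x: "norm x \<le> 1" "norm f - \<eta> \<le> cmod (dual_apply f x)" by blast
  obtain c where c: "cmod c = 1" "c * dual_apply f x = complex_of_real (cmod (dual_apply f x))"
    using ex_unit_phase by blast
  show thesis
    by (rule that[of "c *\<^sub>C x"]) (use x c in \<open>auto simp: norm_scaleC dual_apply_scaleC\<close>)
qed

text \<open>If \<open>f\<close> almost attains its norm at \<open>x\<close> and \<open>e x \<approx> x\<close>, then
  \<open>\<bar>f (e x + \<tau> (1 - e) y)\<bar>\<^sup>2 \<le> \<parallel>f\<parallel>\<^sup>2 (1 + \<tau>\<^sup>2)\<close> forces \<open>f ((1 - e) y)\<close> to be small uniformly in \<open>y\<close>.\<close>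

lemma dual_act_dense:
  fixes f :: "'a::cstar_algebra cdual"
  assumes "\<delta> > 0"
  shows "\<exists>e. norm (f - dual_act f e) \<le> \<delta>"
proof -
  define N where "N = norm f"
  have N: "N \<ge> 0" by (simp add: N_def)
  \<comment> \<open>Chosen so that the final bound \<open>\<tau> * (2 * N + 1)\<close> equals
    \<open>\<delta>\<close>.\<close>
  define \<tau> where "\<tau> = \<delta> / (2 * N + 1)"
  have \<tau>: "\<tau> > 0" using assms N by (simp add: \<tau>_def)
  obtain x where x: "norm x \<le> 1" "dual_apply f x = complex_of_real (cmod (dual_apply f x))"
    "N - \<tau>\<^sup>2 \<le> cmod (dual_apply f x)"
    using ex_almost_norming[of "\<tau>\<^sup>2" f] \<tau> unfolding N_def by auto
  obtain e where e: "positive_contraction e" "norm (e * x - x) < \<tau>\<^sup>2"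
    using eventually_happens'[OF approximate_units_neq_bot eventually_approximate_units[of "\<tau>\<^sup>2" x]] \<tau>
    by auto
  have main: "cmod (dual_apply f (y - e * y)) \<le> \<delta>" if y: "norm y \<le> 1" for y
  proof -
    let ?m = "cmod (dual_apply f (y - e * y))"
    obtain c where c: "cmod c = 1" "c * dual_apply f (y - e * y) = complex_of_real ?m"
      using ex_unit_phase by blast
    \<comment> \<open>The phase makes the contribution of \<open>y\<close> real and nonnegative, so
      it adds to \<open>f x\<close> without cancellation.\<close>
    define y' where "y' = (of_real \<tau> * c) *\<^sub>C y"
    have "norm y' \<le> \<tau>" using y \<tau> c by (simp add: y'_def norm_scaleC norm_mult mult_left_le)
    then have "(norm y')\<^sup>2 \<le> \<tau>\<^sup>2" by (simp add: power_mono)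
    moreover have "(norm x)\<^sup>2 \<le> 1" using x(1) by (simp add: power_le_one)
    ultimately have "(norm (e * x + (y' - e * y')))\<^sup>2 \<le> 1 + \<tau>\<^sup>2"
      using norm_convex_combination_le[OF e(1), of x y'] by linarith
    \<comment> \<open>Completing the square removes the square root; the gain over 1 is of second
      order in \<open>\<tau>\<close>, while the term to be estimated is of first order.\<close>
    also have "\<dots> \<le> (1 + \<tau>\<^sup>2 / 2)\<^sup>2" by (simp add: power2_sum)
    finally have "norm (e * x + (y' - e * y')) \<le> 1 + \<tau>\<^sup>2 / 2"
      by (rule power2_le_imp_le) simp
    then have 1: "cmod (dual_apply f (e * x + (y' - e * y'))) \<le> N * (1 + \<tau>\<^sup>2 / 2)"
      unfolding N_def by (rule norm_dual_apply_le)
    have "y' - e * y' = (of_real \<tau> * c) *\<^sub>C (y - e * y)"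
      by (simp add: y'_def scaleC_mult_right scaleC_diff_right)
    then have "dual_apply f (y' - e * y') = of_real \<tau> * (c * dual_apply f (y - e * y))"
      by (simp add: dual_apply_scaleC mult.assoc)
    then have fy': "dual_apply f (y' - e * y') = of_real (\<tau> * ?m)" by (simp only: c of_real_mult)
    have "e * x + (y' - e * y') = x + (e * x - x) + (y' - e * y')" by simp
    then have "dual_apply f (e * x + (y' - e * y')) =
        of_real (cmod (dual_apply f x)) + dual_apply f (e * x - x) + of_real (\<tau> * ?m)"
      using x(2) fy' by (simp only: dual_apply_add)
    then have "cmod (dual_apply f x) + Re (dual_apply f (e * x - x)) + \<tau> * ?m
        = Re (dual_apply f (e * x + (y' - e * y')))" by simp
    also have "\<dots> \<le> N * (1 + \<tau>\<^sup>2 / 2)"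
      using 1 complex_Re_le_cmod order_trans by blast
    finally have 2: "cmod (dual_apply f x) + Re (dual_apply f (e * x - x)) + \<tau> * ?m \<le> N * (1 + \<tau>\<^sup>2 / 2)" .
    have "cmod (dual_apply f (e * x - x)) \<le> N * \<tau>\<^sup>2"
      unfolding N_def using e(2) by (intro norm_dual_apply_le) simp
    then have 3: "Re (dual_apply f (e * x - x)) \<ge> - (N * \<tau>\<^sup>2)"
      using abs_Re_le_cmod[of "dual_apply f (e * x - x)"] by linarith
    have "\<tau> * ?m \<le> N * (1 + \<tau>\<^sup>2 / 2) - (N - \<tau>\<^sup>2) + N * \<tau>\<^sup>2"
      using 2 3 x(3) by linarith
    also have "\<dots> \<le> \<tau> * (\<tau> * (2 * N + 1))"
      using N by (simp add: algebra_simps power2_eq_square)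
    finally have "?m \<le> \<tau> * (2 * N + 1)" using \<tau> by simp
    also have "\<dots> = \<delta>" using N by (simp add: \<tau>_def)
    finally show ?thesis .
  qed
  have "cmod (dual_apply (f - dual_act f e) y) \<le> \<delta> * norm y" for y
  proof (cases "y = 0")
    case True then show ?thesis using dual_apply_scaleC[of _ 0 0] by simp
  next
    case False
    have "(1 / norm y) *\<^sub>R y - e * (1 / norm y) *\<^sub>R y = (1 / norm y) *\<^sub>R (y - e * y)"
      by (simp add: algebra_simps)
    then have "cmod (dual_apply f (y - e * y)) / norm y \<le> \<delta>"
      using main[of "(1 / norm y) *\<^sub>R y"] False by (simp add: dual_apply_scaleR norm_mult norm_divide)
    then show ?thesis
      using False by (simp add: minus_cdual.rep_eq dual_act.rep_eq dual_apply_diff divide_simps)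
  qed
  then have "norm (f - dual_act f e) \<le> \<delta>" using assms by (intro norm_dual_bound) auto
  then show ?thesis ..
qed

text \<open>Multiplying by \<open>bidual_embed b\<close> on the left amounts to evaluating at
  \<open>dual_act f b\<close>, and these functionals approximate \<open>f\<close> in norm.\<close>

lemma bidual_nondegenerate:
  fixes y z :: "'a::cstar_algebra bidual"
  assumes "\<And>b. bidual_embed b \<box> y = bidual_embed b \<box> z"
  shows "y = z"
proof (rule dual_eqI)
  fix f :: "'a cdual"
  have eq: "dual_apply (bidual_embed b \<box> x) f = dual_apply x (dual_act f b)" for b and x :: "'a bidual"
    by (simp add: bidual_mult.rep_eq bidual_embed.rep_eq bidual_act.rep_eq)
  have "norm (dual_apply (y - z) f) \<le> e" if e: "e > 0" for e :: real
  proof -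
    have pos: "norm (y - z) + 1 > 0" by (simp add: add_nonneg_pos)
    obtain b where b: "norm (f - dual_act f b) \<le> e / (norm (y - z) + 1)"
      using dual_act_dense[OF divide_pos_pos[OF e pos]] by blast
    have "dual_apply (y - z) (dual_act f b) = 0"
      using eq[of b y] eq[of b z] assms[of b] by (simp add: minus_cdual.rep_eq)
    then have "norm (dual_apply (y - z) f) = norm (dual_apply (y - z) (f - dual_act f b))"
      by (simp add: dual_apply_diff)
    also have "\<dots> \<le> norm (y - z) * norm (f - dual_act f b)" by (rule norm_dual_apply)
    also have "\<dots> \<le> (norm (y - z) + 1) * (e / (norm (y - z) + 1))"
      using b that pos by (intro mult_mono) auto
    also have "\<dots> = e" using pos by simp
    finally show ?thesis .
  qed
  then have "dual_apply (y - z) f = 0" by (metis field_le_epsilon add_0 norm_le_zero_iff)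
  then show "dual_apply y f = dual_apply z f" by (simp add: minus_cdual.rep_eq)
qed

lemma scaleC_sum_left: "sum f A *\<^sub>C (x :: 'a::complex_normed_vector) = (\<Sum>i\<in>A. f i *\<^sub>C x)"
  by (induction A rule: infinite_finite_induct) (auto simp: scaleC_add_left)

section \<open>Isometries preserve the triple product\<close>

text \<open>The vector field \<open>a - x a\<^sup>* x\<close> is tangent to the unit sphere to second order: with \<open>s = x\<^sup>* a\<close>,
  \<open>1 - y\<^sup>* y = (1 - t s) (1 - x\<^sup>* x) (1 - t s\<^sup>*) - t\<^sup>2 E\<close> for \<open>y = x + t (a - x a\<^sup>* x)\<close>,
  where \<open>\<parallel>E\<parallel> \<le> 5 \<parallel>a\<parallel>\<^sup>2\<close>.\<close>

lemma norm_unit_ball_flow: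
  fixes x a :: "'a::cstar_algebra"
  assumes x: "norm x \<le> 1"
  shows "norm (x + t *\<^sub>R (a - x * star a * x)) \<le> 1 + 3 * (norm a)\<^sup>2 * t\<^sup>2"
proof -
  define X where "X = emb x"
  define A where "A = emb a"
  define S where "S = star X * A"
  define P where "P = star X * X"
  define W where "W = A - X * star A * X"
  define Y where "Y = X + t *\<^sub>R W"
  define E where "E = S * (1 - P) * star S + star W * W"
  define D where "D = (1 - t *\<^sub>R S) * (1 - P) * star (1 - t *\<^sub>R S)"
  have nX: "norm X \<le> 1" "norm A = norm a" using x by (simp_all add: X_def A_def)
  have nS: "norm S \<le> norm a"
    using norm_mult_ineq[of "star X" A] nX mult_right_mono[of "norm X" 1 "norm a"]
    by (simp add: S_def norm_star)
  have P: "positive P" "norm P \<le> 1"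
    using nX by (simp_all add: P_def positive_star_mult cstar_identity power_le_one)
  have P1: "positive (1 - P)" using positive_of_real_diff[OF positive_selfadjoint[OF P(1)], of 1] P(2) by simp
  have nP1: "norm (1 - P) \<le> 1" using norm_of_real_diff_le[of P 1] P by simp
  have "norm (X * star A * X) \<le> norm X * norm (star A) * norm X"
    by (meson mult_right_mono norm_ge_zero norm_mult_ineq order_trans)
  also have "\<dots> \<le> 1 * norm (star A) * 1" using nX by (intro mult_mono) auto
  finally have nW: "norm W \<le> 2 * norm a"
    using norm_triangle_ineq4[of A "X * star A * X"] nX by (simp add: W_def norm_star)
  have "norm (S * (1 - P) * star S) \<le> norm S * norm (1 - P) * norm (star S)"
    by (meson mult_right_mono norm_ge_zero norm_mult_ineq order_trans)
  also have "\<dots> \<le> norm a * 1 * norm a"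
    using nS nP1 by (intro mult_mono) (auto simp: norm_star)
  finally have "norm (S * (1 - P) * star S) \<le> (norm a)\<^sup>2" by (simp add: power2_eq_square)
  moreover have "norm (star W * W) \<le> (2 * norm a)\<^sup>2"
    using power_mono[OF nW norm_ge_zero, of 2] by (simp add: cstar_identity)
  \<comment> \<open>5 is 1 from the first summand of \<open>E\<close> plus the square of the 2 in
    the bound for \<open>W\<close>.\<close>
  ultimately have nE: "norm E \<le> 5 * (norm a)\<^sup>2"
    unfolding E_def by (intro norm_triangle_le) (simp add: power2_eq_square)
  have sE: "star E = E"
    by (simp add: E_def P_def star_add star_mult star_diff star_star mult.assoc)
  have D: "positive D"
    using positive_conjugate[OF P1, of "star (1 - t *\<^sub>R S)"] by (simp add: D_def star_star)
  have id: "1 - star Y * Y = D - (t * t) *\<^sub>R E"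
    by (simp add: D_def E_def Y_def W_def P_def S_def star_add star_diff star_mult star_star
        star_scaleR algebra_simps)
  define k where "k = 5 * (norm a)\<^sup>2 * (t * t)"
  have "norm ((t * t) *\<^sub>R E) \<le> k"
    using mult_left_mono[OF nE, of "t * t"] by (simp add: k_def mult.commute)
  then have "positive (of_real k - (t * t) *\<^sub>R E)"
    by (intro positive_of_real_diff) (simp_all add: star_scaleR sE)
  moreover have "of_real (1 + k) - star Y * Y = D + (of_real k - (t * t) *\<^sub>R E)"
    using id by (simp add: algebra_simps)
  ultimately have Y: "positive (of_real (1 + k) - star Y * Y)"
    by (simp only: positive_add[OF D])
  have k0: "k \<ge> 0" by (simp add: k_def)
  then have "norm (star Y * Y) \<le> 1 + k"
    by (intro norm_le_of_positive_diff positive_star_mult Y) simp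
  then have "(norm Y)\<^sup>2 \<le> 1 + k" by (simp add: cstar_identity)
  also have "\<dots> \<le> (1 + 3 * (norm a)\<^sup>2 * t\<^sup>2)\<^sup>2"
  proof -
    \<comment> \<open>Any constant from 5/2 upwards works in place of 3.\<close>
    have "1 + 5 * m \<le> (1 + 3 * m)\<^sup>2" if "m \<ge> 0" for m :: real
      using that mult_nonneg_nonneg[OF that that] by (simp add: power2_eq_square algebra_simps)
    from this[of "(norm a)\<^sup>2 * t\<^sup>2"] show ?thesis
      by (simp add: k_def power2_eq_square[of t] mult.assoc)
  qed
  finally have "norm Y \<le> 1 + 3 * (norm a)\<^sup>2 * t\<^sup>2" by (rule power2_le_imp_le) simp
  moreover have "Y = emb (x + t *\<^sub>R (a - x * star a * x))"
    by (simp add: Y_def W_def X_def A_def emb_simps)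
  ultimately show ?thesis by simp
qed

text \<open>A root-of-unity average isolates the linear coefficient of a polynomial.\<close>

inductive polynomial_of_order :: "nat \<Rightarrow> (complex \<Rightarrow> 'a::complex_normed_vector) \<Rightarrow> bool"
  for m :: nat where
  zero: "polynomial_of_order m (\<lambda>_. 0)"
| monomial: "k \<ge> m \<Longrightarrow> polynomial_of_order m (\<lambda>\<tau>. \<tau> ^ k *\<^sub>C v)"
| add: "polynomial_of_order m P \<Longrightarrow> polynomial_of_order m Q \<Longrightarrow> polynomial_of_order m (\<lambda>\<tau>. P \<tau> + Q \<tau>)"

lemma polynomial_of_order_mono:
  "polynomial_of_order m P \<Longrightarrow> n \<le> m \<Longrightarrow> polynomial_of_order n P"
  by (induction rule: polynomial_of_order.induct) (auto intro: polynomial_of_order.intros)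

lemma polynomial_of_order_const: "polynomial_of_order 0 (\<lambda>_. v)"
  using polynomial_of_order.monomial[of 0 0 v] by simp

lemma polynomial_of_order_times:
  "polynomial_of_order m P \<Longrightarrow> polynomial_of_order (m + i) (\<lambda>\<tau>. \<tau> ^ i *\<^sub>C P \<tau>)"
proof (induction rule: polynomial_of_order.induct)
  case (monomial k v)
  then show ?case
    using polynomial_of_order.monomial[of "m + i" "i + k" v] by (simp add: scaleC_scaleC power_add)
qed (auto simp: scaleC_add_right intro: polynomial_of_order.intros)

lemma polynomial_of_order_bilinear:
  fixes B :: "'a::complex_normed_vector \<Rightarrow> 'b::complex_normed_vector \<Rightarrow> 'c::complex_normed_vector"
  assumes add_l: "\<And>x y z. B (x + y) z = B x z + B y z" and add_r: "\<And>x y z. B x (y + z) = B x y + B x z"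
    and sc_l: "\<And>c x y. B (c *\<^sub>C x) y = c *\<^sub>C B x y" and sc_r: "\<And>c x y. B x (c *\<^sub>C y) = c *\<^sub>C B x y"
    and P: "polynomial_of_order m P" and Q: "polynomial_of_order n Q"
  shows "polynomial_of_order (m + n) (\<lambda>\<tau>. B (P \<tau>) (Q \<tau>))"
  using P
proof (induction rule: polynomial_of_order.induct)
  case zero
  have "B 0 y = 0" for y using sc_l[of 0 0 y] by simp
  then show ?case by (simp add: polynomial_of_order.zero)
next
  case (add P P')
  then show ?case unfolding add_l by (intro polynomial_of_order.add)
next
  case (monomial k v)
  from Q have "polynomial_of_order (n + k) (\<lambda>\<tau>. \<tau> ^ k *\<^sub>C B v (Q \<tau>))"
  proof (induction rule: polynomial_of_order.induct)
    case zero
    have "B v 0 = 0" using sc_r[of v 0 0] by simp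
    then show ?case by (simp add: polynomial_of_order.zero)
  next
    case (add P P')
    then show ?case unfolding add_r scaleC_add_right by (intro polynomial_of_order.add)
  next
    case (monomial j w)
    then show ?case
      using polynomial_of_order.monomial[of "n + k" "k + j" "B v w"]
      by (simp add: sc_r scaleC_scaleC power_add)
  qed
  then show ?case
    unfolding sc_l by (rule polynomial_of_order_mono) (use monomial in simp)
qed

text \<open>A geometric sum with ratio \<open>\<omega>\<close> to the power \<open>k - 1\<close>.
  The ratio differs from 1 because \<open>k - 1\<close> is nonzero and smaller than \<open>N\<close>
  in absolute value; \<open>k = 0\<close> is included and removes constant terms.\<close>

lemma sum_roots_of_unity:
  fixes k N :: nat
  assumes "k \<noteq> 1" "k < N" "N > 1"
  defines "\<omega> \<equiv> cis (2 * pi / real N)"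
  shows "(\<Sum>j<N. inverse (\<omega> ^ j) * (\<omega> ^ j) ^ k) = 0"
proof -
  define z where "z = inverse \<omega> * \<omega> ^ k"
  have z_eq: "inverse (\<omega> ^ j) * (\<omega> ^ j) ^ k = z ^ j" for j
    by (simp add: z_def power_mult_distrib power_inverse mult.commute flip: power_mult)
  have "\<omega> ^ N = cis (real N * (2 * pi / real N))" unfolding \<omega>_def by (rule Complex.DeMoivre)
  also have "real N * (2 * pi / real N) = 2 * pi" using assms(3) by simp
  finally have \<omega>N: "\<omega> ^ N = 1" by simp
  have zc: "z = cis (2 * pi * (real k - 1) / real N)"
    by (simp add: z_def \<omega>_def Complex.DeMoivre cis_mult diff_divide_distrib algebra_simps)
  have "z \<noteq> 1"
  proof
    assume "z = 1"
    then have "cos (2 * pi * (real k - 1) / real N) = 1" using zc by (metis cis.sel(1) one_complex.sel(1))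
    then obtain i :: int where "2 * pi * (real k - 1) / real N = of_int i * 2 * pi"
      by (auto simp: cos_one_2pi_int)
    then have "(2 * pi) * (real k - 1) = (2 * pi) * (of_int i * real N)"
      using assms(3) by (simp add: field_simps)
    then have "real k - 1 = of_int i * real N" unfolding mult_cancel_left using pi_neq_zero by simp
    then have i: "int k - 1 = i * int N"
    proof -
      have "(of_int (int k - 1) :: real) = of_int (i * int N)"
        using \<open>real k - 1 = of_int i * real N\<close> by simp
      then show ?thesis by (simp only: of_int_eq_iff)
    qed
    have "\<bar>int k - 1\<bar> < int N" using assms by linarith
    then have "\<bar>i\<bar> * int N < 1 * int N" by (simp add: i abs_mult)
    then have "i = 0" by (simp only: mult_less_cancel_right) auto
    with i assms(1) show False by simp
  qed
  moreover have "z ^ N = 1"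
    by (simp add: z_def power_mult_distrib power_inverse \<omega>N flip: power_mult)
      (metis \<omega>N mult.commute power_mult power_one)
  ultimately show ?thesis
    unfolding z_eq using geometric_sum[of z N] by simp
qed

text \<open>\<open>N\<close> has to exceed every exponent that occurs. The predicate records no
  degree, so the claim is made for all large \<open>N\<close>, a form that is stable under
  sums.\<close>

lemma polynomial_average:
  assumes "polynomial_of_order 2 P"
  shows "\<forall>\<^sub>F N in sequentially. \<forall>r. (\<Sum>j<N. inverse (cis (2 * pi / real N) ^ j) *\<^sub>C
    P (of_real r * cis (2 * pi / real N) ^ j)) = 0"
  using assms
proof (induction rule: polynomial_of_order.induct)
  case zero
  show ?case by simp
next
  case (monomial k v)
  have "\<forall>\<^sub>F N in sequentially. N > k" by (rule eventually_gt_at_top)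
  then show ?case
  proof eventually_elim
    case (elim N)
    have "(\<Sum>j<N. inverse (cis (2 * pi / real N) ^ j) *\<^sub>C
        (of_real r * cis (2 * pi / real N) ^ j) ^ k *\<^sub>C v) =
        (\<Sum>j<N. of_real r ^ k * (inverse (cis (2 * pi / real N) ^ j) *
        (cis (2 * pi / real N) ^ j) ^ k)) *\<^sub>C v" for r
      unfolding scaleC_sum_left by (simp add: scaleC_scaleC power_mult_distrib mult_ac)
    moreover have "(\<Sum>j<N. inverse (cis (2 * pi / real N) ^ j) * (cis (2 * pi / real N) ^ j) ^ k) = 0"
      by (rule sum_roots_of_unity) (use monomial elim in auto)
    ultimately show ?case by (simp flip: sum_distrib_left)
  qed
next
  case (add P Q)
  from add.IH show ?case
    by eventually_elim (simp add: scaleC_add_right sum.distrib)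
qed

text \<open>Cauchy's estimate for the first coefficient, with the contour integral replaced by a
  finite average.\<close>

lemma norm_linear_coefficient_le:
  fixes b c :: "'a::complex_normed_vector"
  assumes P: "polynomial_of_order 2 P" and r: "r > 0"
    and bd: "\<And>\<tau>. cmod \<tau> = r \<Longrightarrow> norm (b + \<tau> *\<^sub>C c + P \<tau>) \<le> K"
  shows "r * norm c \<le> K"
proof -
  have "\<forall>\<^sub>F N :: nat in sequentially. N > 1" by (rule eventually_gt_at_top)
  with polynomial_average[OF P] have "\<forall>\<^sub>F N in sequentially. N > 1 \<and> (\<forall>r. (\<Sum>j<N.
    inverse (cis (2 * pi / real N) ^ j) *\<^sub>C P (of_real r * cis (2 * pi / real N) ^ j)) = 0)"
    by eventually_elim simp
  from eventually_happens'[OF sequentially_bot this] obtain N :: nat where N: "N > 1"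
    and "\<forall>r. (\<Sum>j<N. inverse (cis (2 * pi / real N) ^ j) *\<^sub>C
      P (of_real r * cis (2 * pi / real N) ^ j)) = 0" by blast
  then have avg: "(\<Sum>j<N. inverse (cis (2 * pi / real N) ^ j) *\<^sub>C
      P (of_real r * cis (2 * pi / real N) ^ j)) = 0" by blast
  define \<omega> where "\<omega> = cis (2 * pi / real N)"
  have \<omega>: "cmod (\<omega> ^ j) = 1" "\<omega> ^ j \<noteq> 0" for j by (simp_all add: \<omega>_def norm_power)
  have "(\<Sum>j<N. inverse (\<omega> ^ j) * (\<omega> ^ j) ^ 0) = 0"
    unfolding \<omega>_def by (rule sum_roots_of_unity) (use N in auto)
  then have b0: "(\<Sum>j<N. inverse (\<omega> ^ j) *\<^sub>C b) = 0"
    unfolding scaleC_sum_left[symmetric] by simp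
  have cancel: "inverse (\<omega> ^ j) * (of_real r * \<omega> ^ j) = of_real r" for j
    using \<omega>(2)[of j] by (auto simp: field_simps)
  have "(\<Sum>j<N. inverse (\<omega> ^ j) *\<^sub>C (b + (of_real r * \<omega> ^ j) *\<^sub>C c + P (of_real r * \<omega> ^ j)))
      = (\<Sum>j<N. of_real r *\<^sub>C c)"
    using b0 avg unfolding \<omega>_def[symmetric]
    by (simp add: scaleC_add_right sum.distrib scaleC_scaleC cancel)
  also have "\<dots> = real N *\<^sub>R r *\<^sub>R c" by (simp add: sum_constant_scaleR scaleR_scaleC)
  finally have "real N * (r * norm c)
      = norm (\<Sum>j<N. inverse (\<omega> ^ j) *\<^sub>C (b + (of_real r * \<omega> ^ j) *\<^sub>C c + P (of_real r * \<omega> ^ j)))"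
    using r by simp
  also have "\<dots> \<le> (\<Sum>j<N. K)"
  proof (rule sum_norm_le)
    fix j
    have "cmod (of_real r * \<omega> ^ j) = r" using \<omega> r by (simp add: norm_mult)
    from bd[OF this] show
      "norm (inverse (\<omega> ^ j) *\<^sub>C (b + (of_real r * \<omega> ^ j) *\<^sub>C c + P (of_real r * \<omega> ^ j))) \<le> K"
      using \<omega> by (simp add: norm_scaleC norm_inverse)
  qed
  finally show ?thesis using N by simp
qed


text \<open>The flow of a homogeneous quadratic vector field tangent to the unit sphere would be bounded
  on all complex times. Here the flow is replaced by the iterates of \<open>z \<mapsto> z + \<tau> B z z\<close>, so that
  Liouville's argument only concerns polynomials in \<open>\<tau>\<close>.\<close>

lemma tangent_quadratic_eq_zero:
  fixes B :: "'a::complex_normed_vector \<Rightarrow> 'a \<Rightarrow> 'a"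
  assumes add_l: "\<And>x y z. B (x + y) z = B x z + B y z" and add_r: "\<And>x y z. B x (y + z) = B x y + B x z"
    and sc_l: "\<And>c x y. B (c *\<^sub>C x) y = c *\<^sub>C B x y" and sc_r: "\<And>c x y. B x (c *\<^sub>C y) = c *\<^sub>C B x y"
    and tangent: "\<And>z t. norm z \<le> 1 \<Longrightarrow> norm (z + t *\<^sub>R B z z) \<le> 1 + K * t\<^sup>2"
    and K: "K \<ge> 0"
  shows "B z z = 0"
proof -
  define g where "g = (\<lambda>\<tau> z. z + \<tau> *\<^sub>C B z z)"
  \<comment> \<open>By homogeneity a phase can be moved from the time \<open>\<tau>\<close> to the
    point \<open>z\<close>, so the real tangency condition covers complex times.\<close>
  have complex: "norm (g \<tau> z) \<le> 1 + K * (cmod \<tau>)\<^sup>2" if z: "norm z \<le> 1" for z \<tau>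
  proof -
    obtain c where c: "cmod c = 1" "c * \<tau> = complex_of_real (cmod \<tau>)"
      using ex_unit_phase by blast
    then have c0: "c \<noteq> 0" by auto
    define z' where "z' = inverse c *\<^sub>C z"
    have zz: "z = c *\<^sub>C z'" using c0 by (simp add: z'_def scaleC_scaleC)
    have "g \<tau> z = c *\<^sub>C (z' + (c * \<tau>) *\<^sub>C B z' z')"
      unfolding g_def zz by (simp add: sc_l sc_r scaleC_scaleC scaleC_add_right mult_ac)
    also have "\<dots> = c *\<^sub>C (z' + cmod \<tau> *\<^sub>R B z' z')" by (simp add: c scaleR_scaleC)
    finally have "norm (g \<tau> z) = norm (z' + cmod \<tau> *\<^sub>R B z' z')" by (simp add: norm_scaleC c)
    also have "\<dots> \<le> 1 + K * (cmod \<tau>)\<^sup>2"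
      by (rule tangent) (use z c in \<open>simp add: z'_def norm_scaleC norm_inverse\<close>)
    finally show ?thesis .
  qed
  \<comment> \<open>Homogeneity in the radius: the iterates may leave the unit ball but stay in the
    ball of radius 2, whence the factor 4.\<close>
  have large: "norm (g \<tau> z) \<le> norm z * (1 + 4 * K * (cmod \<tau>)\<^sup>2)" if z: "norm z \<le> 2" for z \<tau>
  proof (cases "z = 0")
    case True
    then show ?thesis using sc_l[of 0 0 0] by (simp add: g_def)
  next
    case False
    define \<rho> where "\<rho> = complex_of_real (norm z)"
    have \<rho>: "cmod \<rho> = norm z" "\<rho> \<noteq> 0" using False by (simp_all add: \<rho>_def)
    define z' where "z' = inverse \<rho> *\<^sub>C z"
    have zz: "z = \<rho> *\<^sub>C z'" using \<rho> by (simp add: z'_def scaleC_scaleC)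
    have n: "norm z' \<le> 1" using \<rho> False by (simp add: z'_def norm_scaleC norm_inverse)
    have "g \<tau> z = \<rho> *\<^sub>C g (\<rho> * \<tau>) z'"
      unfolding g_def by (subst (1 2 3) zz) (simp add: sc_l sc_r scaleC_scaleC scaleC_add_right mult_ac)
    then have "norm (g \<tau> z) = norm z * norm (g (\<rho> * \<tau>) z')" by (simp add: norm_scaleC \<rho>)
    also have "\<dots> \<le> norm z * (1 + K * (cmod (\<rho> * \<tau>))\<^sup>2)"
      by (intro mult_left_mono complex n) auto
    also have "\<dots> \<le> norm z * (1 + 4 * K * (cmod \<tau>)\<^sup>2)"
    proof -
      have "(norm z)\<^sup>2 \<le> 4" using z power_mono[of "norm z" 2 2] by simp
      then have "K * (cmod \<tau>)\<^sup>2 * (norm z)\<^sup>2 \<le> K * (cmod \<tau>)\<^sup>2 * 4"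
        using K by (intro mult_left_mono) auto
      then show ?thesis
        by (intro mult_left_mono) (auto simp: norm_mult \<rho> power_mult_distrib mult_ac)
    qed
    finally show ?thesis .
  qed
  \<comment> \<open>Only the linear coefficient is needed; the remainder of order at least 2
    vanishes in the average.\<close>
  have expansion: "\<exists>H. polynomial_of_order 2 H \<and>
      (\<forall>\<tau>. (g \<tau> ^^ n) z = z + \<tau> *\<^sub>C (of_nat n *\<^sub>C B z z) + H \<tau>)" for n z
  proof (induction n)
    case 0
    show ?case by (intro exI[of _ "\<lambda>_. 0"]) (auto intro: polynomial_of_order.zero)
  next
    case (Suc n)
    then obtain H where H: "polynomial_of_order 2 H"
      "\<And>\<tau>. (g \<tau> ^^ n) z = z + \<tau> *\<^sub>C (of_nat n *\<^sub>C B z z) + H \<tau>" by blast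
    define W where "W = (\<lambda>\<tau>. \<tau> *\<^sub>C (of_nat n *\<^sub>C B z z) + H \<tau>)"
    have W: "polynomial_of_order 1 W"
      unfolding W_def using polynomial_of_order.monomial[of 1 1 "of_nat n *\<^sub>C B z z"]
      by (intro polynomial_of_order.add polynomial_of_order_mono[OF H(1)]) auto
    define U where "U = (\<lambda>\<tau>. B z (W \<tau>) + B (W \<tau>) z + B (W \<tau>) (W \<tau>))"
    note bil = polynomial_of_order_bilinear[of B, OF add_l add_r sc_l sc_r]
    have "polynomial_of_order 1 U"
      unfolding U_def
      using bil[OF polynomial_of_order_const[of z] W] bil[OF W polynomial_of_order_const[of z]]
        polynomial_of_order_mono[OF bil[OF W W], of 1]
      by (intro polynomial_of_order.add) auto
    from polynomial_of_order_times[OF this, of 1]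
    have U: "polynomial_of_order 2 (\<lambda>\<tau>. \<tau> *\<^sub>C U \<tau>)" by (simp add: numeral_2_eq_2)
    have "(g \<tau> ^^ Suc n) z = z + \<tau> *\<^sub>C (of_nat (Suc n) *\<^sub>C B z z) + (H \<tau> + \<tau> *\<^sub>C U \<tau>)" for \<tau>
    proof -
      have "(g \<tau> ^^ n) z = z + W \<tau>" by (simp add: H(2) W_def add.assoc)
      then have "(g \<tau> ^^ Suc n) z = z + W \<tau> + \<tau> *\<^sub>C (B z z + U \<tau>)"
        by (simp add: g_def U_def add_l add_r add_ac)
      then show ?thesis by (simp add: W_def scaleC_add_left scaleC_add_right add_ac)
    qed
    with polynomial_of_order.add[OF H(1) U] show ?case by blast
  qed
  have small: "B z z = 0" if z: "norm z \<le> 1" for z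
  proof (rule ccontr)
    assume "B z z \<noteq> 0"
    \<comment> \<open>The total time, split into \<open>n\<close> steps of length \<open>r\<close>.
      The linear term then has norm 3 on the circle of radius \<open>r\<close>, against the bound 2
      for the iterates.\<close>
    define R where "R = 3 / norm (B z z)"
    have R: "R > 0" using \<open>B z z \<noteq> 0\<close> by (simp add: R_def)
    \<comment> \<open>Each step costs a factor \<open>1 + x\<close> with \<open>x\<close> of order
      \<open>1 / n^2\<close>; this \<open>n\<close> makes \<open>n * x\<close> at most 1/2, so the
      total growth is at most \<open>exp (1/2)\<close>.\<close>
    obtain n :: nat where n: "8 * K * R\<^sup>2 < real n" using reals_Archimedean2 by blast
    have "0 \<le> 8 * K * R\<^sup>2" using K by simp
    with n have n0: "n > 0" by linarith
    define r where "r = R / real n"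
    have r: "r > 0" using R n0 by (simp add: r_def)
    define x where "x = 4 * K * r\<^sup>2"
    have x: "x \<ge> 0" using K by (simp add: x_def)
    have "real n * x = 4 * K * R\<^sup>2 / real n"
      using n0 by (simp add: x_def r_def power2_eq_square)
    also have "\<dots> \<le> 1 / 2" using n n0 by (simp add: divide_simps)
    finally have nx: "real n * x \<le> 1 / 2" .
    have pow: "(1 + x) ^ k \<le> 2" if "k \<le> n" for k
    proof -
      have "(1 + x) ^ k \<le> (1 + x) ^ n" using x that by (intro power_increasing) auto
      also have "\<dots> \<le> exp x ^ n" using x by (intro power_mono) auto
      also have "\<dots> = exp (real n * x)" by (simp add: exp_of_nat_mult)
      also have "\<dots> \<le> exp (1 / 2)" using nx by simp
      also have "\<dots> \<le> 2" by (rule exp_half_le2)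
      finally show ?thesis .
    qed
    have iter: "norm ((g \<tau> ^^ k) z) \<le> (1 + x) ^ k" if "k \<le> n" "cmod \<tau> = r" for k \<tau>
      using that(1)
    proof (induction k)
      case (Suc k)
      have IH: "norm ((g \<tau> ^^ k) z) \<le> (1 + x) ^ k" using Suc by simp
      also have "\<dots> \<le> 2" using pow Suc by simp
      finally have "norm (g \<tau> ((g \<tau> ^^ k) z)) \<le> norm ((g \<tau> ^^ k) z) * (1 + x)"
        using large[of "(g \<tau> ^^ k) z" \<tau>] by (simp add: x_def that(2))
      also have "\<dots> \<le> (1 + x) ^ k * (1 + x)" using IH x by (intro mult_right_mono) auto
      finally show ?case by (simp add: mult.commute)
    qed (use z in simp)
    obtain H where H: "polynomial_of_order 2 H"
      "\<And>\<tau>. (g \<tau> ^^ n) z = z + \<tau> *\<^sub>C (of_nat n *\<^sub>C B z z) + H \<tau>"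
      using expansion by blast
    have "r * norm (complex_of_nat n *\<^sub>C B z z) \<le> 2"
    proof (rule norm_linear_coefficient_le[OF H(1) r])
      fix \<tau> :: complex assume "cmod \<tau> = r"
      then show "norm (z + \<tau> *\<^sub>C complex_of_nat n *\<^sub>C B z z + H \<tau>) \<le> 2"
        using iter[of n \<tau>] pow[of n] by (simp add: H(2))
    qed
    moreover have "r * norm (complex_of_nat n *\<^sub>C B z z) = 3"
      using n0 \<open>B z z \<noteq> 0\<close> by (simp add: norm_scaleC r_def R_def)
    ultimately show False by simp
  qed
  show ?thesis
  proof (cases "z = 0")
    case True then show ?thesis using sc_l[of 0 0 0] by simp
  next
    case False
    define \<rho> where "\<rho> = complex_of_real (norm z)"
    have \<rho>: "cmod \<rho> = norm z" "\<rho> \<noteq> 0" using False by (simp_all add: \<rho>_def)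
    have "B (inverse \<rho> *\<^sub>C z) (inverse \<rho> *\<^sub>C z) = 0"
      using \<rho> False by (intro small) (simp add: norm_scaleC norm_inverse)
    then have "norm (inverse \<rho> *\<^sub>C inverse \<rho> *\<^sub>C B z z) = 0" by (simp only: sc_l sc_r norm_zero)
    then show ?thesis using \<rho>(2) by (simp only: norm_scaleC norm_inverse) simp
  qed
qed

lemma complex_linear_diff: "complex_linear f \<Longrightarrow> f (x - y) = f x - f y"
  unfolding complex_linear_def by (metis add_diff_cancel diff_add_cancel)

lemma complex_linear_scaleR: "complex_linear f \<Longrightarrow> f (r *\<^sub>R x) = r *\<^sub>R f x"
  by (simp add: complex_linear_def scaleR_scaleC)

lemma isometry_triple_product:
  fixes T :: "'a::cstar_algebra \<Rightarrow> 'b::cstar_algebra"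
  assumes lin: "complex_linear T" and iso: "\<And>x. norm (T x) = norm x" and surj: "surj T"
  shows "T (x * star a * x) = T x * star (T a) * T x"
proof -
  note T_simps = complex_linear_diff[OF lin] complex_linear_scaleR[OF lin]
  have T_add: "T (x + y) = T x + T y" and T_scaleC: "T (c *\<^sub>C x) = c *\<^sub>C T x" for c x y
    using lin by (auto simp: complex_linear_def)
  have inj: "inj T"
  proof (rule injI)
    fix x y assume "T x = T y"
    then have "norm (x - y) = 0" using iso[of "x - y"] by (simp add: T_simps)
    then show "x = y" by simp
  qed
  define S where "S = inv T"
  have TS: "T (S z) = z" and ST: "S (T x) = x" for z x
    using surj inj by (simp_all add: S_def surj_f_inv_f)
  have S_add: "S (y + z) = S y + S z" and S_scaleC: "S (c *\<^sub>C z) = c *\<^sub>C S z" for y z c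
    using ST[of "S y + S z"] ST[of "c *\<^sub>C S z"] by (simp_all add: T_add T_scaleC TS)
  have S_norm: "norm (S z) = norm z" for z using iso[of "S z"] by (simp add: TS)
  define B where "B = (\<lambda>z w. z * star (T a) * w - T (S z * star a * S w))"
  have "B (T x) (T x) = 0"
  proof (rule tangent_quadratic_eq_zero[where B = B and K = "12 * (norm a)\<^sup>2"])
    show "B (x + y) z = B x z + B y z" "B x (y + z) = B x y + B x z" for x y z
      by (simp_all add: B_def S_add T_add distrib_left distrib_right)
    show "B (c *\<^sub>C x) y = c *\<^sub>C B x y" "B x (c *\<^sub>C y) = c *\<^sub>C B x y" for c x y
      by (simp_all add: B_def S_scaleC T_scaleC scaleC_mult_left scaleC_mult_right scaleC_diff_right)
    show "0 \<le> 12 * (norm a)\<^sup>2" by simp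
    show "norm (z + t *\<^sub>R B z z) \<le> 1 + 12 * (norm a)\<^sup>2 * t\<^sup>2" if z: "norm z \<le> 1" for z t
    proof -
      \<comment> \<open>The doubled step compensates for the midpoint: \<open>z + t B z z\<close> is
        the mean of \<open>p\<close> and \<open>q\<close>, and the opposite signs cancel the
        constant term \<open>T a\<close>. The constant 12 is 3 times the square of 2.\<close>
      define p where "p = T (S z + (2 * t) *\<^sub>R (a - S z * star a * S z))"
      define q where "q = z + (- 2 * t) *\<^sub>R (T a - z * star (T a) * z)"
      have p: "norm p \<le> 1 + 12 * (norm a)\<^sup>2 * t\<^sup>2"
        unfolding p_def iso using norm_unit_ball_flow[of "S z" "2 * t" a] z
        by (simp add: S_norm power_mult_distrib)
      have q: "norm q \<le> 1 + 12 * (norm a)\<^sup>2 * t\<^sup>2"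
        unfolding q_def using norm_unit_ball_flow[of z "- 2 * t" "T a"] z
        by (simp add: iso power_mult_distrib)
      have "z + t *\<^sub>R B z z = (1/2) *\<^sub>R (p + q)"
        by (simp add: p_def q_def B_def T_add T_simps TS algebra_simps flip: scaleR_add_left)
      then have "2 * norm (z + t *\<^sub>R B z z) \<le> norm p + norm q"
        using norm_triangle_ineq[of p q] by simp
      then show ?thesis using p q by argo
    qed
  qed
  then show ?thesis by (simp add: B_def ST)
qed

section \<open>Filters of contractions\<close>

lemma tendsto_contraction_mult:
  fixes f g :: "'x \<Rightarrow> 'a::real_normed_algebra"
  assumes "\<forall>\<^sub>F x in F. norm (f x) \<le> 1" "(g \<longlongrightarrow> b) F"
  shows "((\<lambda>x. f x * (g x - b)) \<longlongrightarrow> 0) F" "((\<lambda>x. (g x - b) * f x) \<longlongrightarrow> 0) F"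
proof -
  have lim: "((\<lambda>x. norm (g x - b)) \<longlongrightarrow> 0) F"
    by (intro tendsto_norm_zero LIM_zero assms(2))
  have "\<forall>\<^sub>F x in F. norm (f x * (g x - b)) \<le> norm (g x - b)"
    using assms(1)
  proof eventually_elim
    case (elim x)
    show ?case
      using norm_mult_ineq[of "f x" "g x - b"] mult_right_mono[OF elim, of "norm (g x - b)"] by simp
  qed
  then show "((\<lambda>x. f x * (g x - b)) \<longlongrightarrow> 0) F" by (rule Lim_null_comparison[OF _ lim])
  have "\<forall>\<^sub>F x in F. norm ((g x - b) * f x) \<le> norm (g x - b)"
    using assms(1)
  proof eventually_elim
    case (elim x)
    show ?case
      using norm_mult_ineq[of "g x - b" "f x"] mult_left_mono[OF elim, of "norm (g x - b)"] by simp
  qed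
  then show "((\<lambda>x. (g x - b) * f x) \<longlongrightarrow> 0) F" by (rule Lim_null_comparison[OF _ lim])
qed

text \<open>For contractions, \<open>(1 - k)\<^sup>* (1 - k) \<le> (1 - k) + (1 - k)\<^sup>*\<close>.\<close>

lemma norm_defect_square_le:
  fixes k l c :: "'a::cstar_algebra"
  assumes k: "norm k \<le> 1" and l: "norm l \<le> 1" and c: "star c = c"
  defines "M \<equiv> (c * c - c * k * c) + (c * c - c * l * c)"
  shows "(norm (c - k * c))\<^sup>2 \<le> norm (M + star M)"
proof -
  define K where "K = emb k"
  define L where "L = emb l"
  define C where "C = emb c"
  have C: "star C = C" by (simp add: C_def c flip: emb_star)
  have pos: "positive (1 - star x * x)" if "norm x \<le> 1" for x :: "'a unitization"
  proof -
    have "norm (star x * x) \<le> 1" using that by (simp add: cstar_identity power_le_one)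
    then show ?thesis
      using positive_of_real_diff[OF positive_selfadjoint[OF positive_star_mult[of x]], of 1] by simp
  qed
  have conj: "positive (C * x * C)" if "positive x" for x
    using positive_conjugate[OF that, of C] by (simp add: C)
  define Z where "Z = emb (c - k * c)"
  have Z: "Z = C - K * C" by (simp add: Z_def C_def K_def emb_simps)
  \<comment> \<open>For each contraction, \<open>(1 - k) + (1 - k)*\<close> is
    \<open>(1 - k)* (1 - k)\<close> plus the defect \<open>1 - k* k\<close>. The contribution of
    \<open>l\<close> is positive, so the symmetrized sum controls \<open>k\<close> alone.\<close>
  have M: "emb (M + star M) - star Z * Z = C * (1 - star K * K) * C + C * (1 - star L * L) * C
      + star (C - L * C) * (C - L * C)"
    by (simp add: M_def Z emb_simps star_add star_diff star_mult C algebra_simps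
        flip: C_def K_def L_def)
  have "norm (star Z * Z) \<le> norm (emb (M + star M))"
  proof (rule norm_mono_positive[OF positive_star_mult])
    show "positive (emb (M + star M) - star Z * Z)"
      unfolding M by (intro positive_add conj pos positive_star_mult) (auto simp: K_def L_def k l)
  qed
  then show ?thesis by (simp add: cstar_identity Z_def)
qed

text \<open>\<open>norm_defect_square_le\<close> needs \<open>k\<close> and \<open>l\<close>
  enclosed by \<open>c\<close> on both sides, while the hypotheses put them on opposite sides of
  \<open>b\<close>. Asymptotic commutation of \<open>k\<close> with squares moves \<open>k\<close>
  to the inside; the result for squares then extends to self-adjoint and to all elements.\<close>

lemma tendsto_mult_of_symmetrized:
  fixes k l :: "'x \<Rightarrow> 'a::cstar_algebra"
  assumes bd: "\<forall>\<^sub>F x in F. norm (k x) \<le> 1" "\<forall>\<^sub>F x in F. norm (l x) \<le> 1"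
    and E1: "\<And>b. ((\<lambda>x. k x * b + b * l x) \<longlongrightarrow> 2 *\<^sub>R b) F"
    and E2: "\<And>b. ((\<lambda>x. b * k x + l x * b) \<longlongrightarrow> 2 *\<^sub>R b) F"
  shows "((\<lambda>x. k x * b) \<longlongrightarrow> b) F"
proof -
  have E1': "((\<lambda>x. (b - k x * b) + (b - b * l x)) \<longlongrightarrow> 0) F" for b
    using tendsto_diff[OF tendsto_const[of "2 *\<^sub>R b"] E1[of b]] by (simp add: scaleR_2 algebra_simps)
  have E2': "((\<lambda>x. (b - b * k x) + (b - l x * b)) \<longlongrightarrow> 0) F" for b
    using tendsto_diff[OF tendsto_const[of "2 *\<^sub>R b"] E2[of b]] by (simp add: scaleR_2 algebra_simps)
  have square: "((\<lambda>x. h * h - k x * (h * h)) \<longlongrightarrow> 0) F" if h: "star h = h" for h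
  proof -
    define c where "c = h * h"
    have c: "star c = c" by (simp add: c_def star_mult h)
    \<comment> \<open>Both expressions contain \<open>h * l x * h\<close>; it cancels in the
      difference, leaving the commutator of \<open>k x\<close> with \<open>h * h\<close>.\<close>
    have "((\<lambda>x. ((h - k x * h) + (h - h * l x)) * h - h * ((h - h * k x) + (h - l x * h))) \<longlongrightarrow> 0 * h - h * 0) F"
      by (intro tendsto_intros E1' E2')
    then have comm: "((\<lambda>x. c * k x - k x * c) \<longlongrightarrow> 0) F"
      by (simp add: c_def algebra_simps)
    define M where "M = (\<lambda>x. (c * c - c * k x * c) + (c * c - c * l x * c))"
    have "((\<lambda>x. ((c - k x * c) + (c - c * l x)) * c - (c * k x - k x * c) * c) \<longlongrightarrow> 0 * c - 0 * c) F"
      by (intro tendsto_intros E1' comm)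
    then have M: "(M \<longlongrightarrow> 0) F" by (simp add: M_def algebra_simps)
    have "((\<lambda>x. norm (M x + star (M x))) \<longlongrightarrow> norm (0 + star (0 :: 'a))) F"
      by (intro tendsto_intros tendsto_star M)
    then have lim: "((\<lambda>x. sqrt (norm (M x + star (M x)))) \<longlongrightarrow> 0) F"
      using tendsto_real_sqrt by fastforce
    have "\<forall>\<^sub>F x in F. norm (c - k x * c) \<le> sqrt (norm (M x + star (M x)))"
      using bd
    proof eventually_elim
      case (elim x)
      show ?case
        unfolding M_def using norm_defect_square_le[OF elim c] by (rule real_le_rsqrt)
    qed
    then show ?thesis unfolding c_def[symmetric] by (rule Lim_null_comparison[OF _ lim])
  qed
  have sa: "((\<lambda>x. h - k x * h) \<longlongrightarrow> 0) F" if h: "star h = h" for h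
  proof -
    have "((\<lambda>x. sqrt (2 * norm (h * h - k x * (h * h)))) \<longlongrightarrow> sqrt (2 * norm (0 :: 'a))) F"
      by (intro tendsto_intros square h)
    then have lim: "((\<lambda>x. sqrt (2 * norm (h * h - k x * (h * h)))) \<longlongrightarrow> 0) F" by simp
    have "\<forall>\<^sub>F x in F. norm (h - k x * h) \<le> sqrt (2 * norm (h * h - k x * (h * h)))"
      using bd(1)
    proof eventually_elim
      case (elim x)
      define d where "d = h * h - k x * (h * h)"
      have "(h - k x * h) * star (h - k x * h) = d - d * star (k x)"
        by (simp add: d_def star_diff star_mult h algebra_simps)
      then have "(norm (h - k x * h))\<^sup>2 = norm (d - d * star (k x))"
        using norm_star_mult[of "h - k x * h"] by simp
      also have "\<dots> \<le> norm d + norm d * norm (star (k x))"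
        using norm_triangle_ineq4 norm_mult_ineq by (meson add_left_mono order_trans)
      also have "\<dots> \<le> 2 * norm d"
        using mult_left_mono[OF elim, of "norm d"] by (simp add: norm_star)
      finally show ?case unfolding d_def by (rule real_le_rsqrt)
    qed
    then show ?thesis by (rule Lim_null_comparison[OF _ lim])
  qed
  obtain h g where hg: "star h = h" "star g = g" "b = h + \<i> *\<^sub>C g"
    by (rule selfadjoint_decomposition)
  have "((\<lambda>x. (h - k x * h) + \<i> *\<^sub>C (g - k x * g)) \<longlongrightarrow> 0 + \<i> *\<^sub>C 0) F"
    by (intro tendsto_intros tendsto_scaleC sa hg(1,2))
  then have "((\<lambda>x. b - k x * b) \<longlongrightarrow> 0) F"
    by (simp add: hg(3) scaleC_diff_right scaleC_mult_right algebra_simps)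
  from tendsto_diff[OF tendsto_const[of b] this] show ?thesis by simp
qed

lemma convergent_filterI:
  fixes h :: "'x \<Rightarrow> 'a::banach"
  assumes F: "F \<noteq> bot" and approx: "\<And>\<epsilon>. \<epsilon> > 0 \<Longrightarrow> \<exists>l. \<forall>\<^sub>F x in F. norm (h x - l) < \<epsilon>"
  shows "\<exists>l. (h \<longlongrightarrow> l) F"
proof -
  have "cauchy_filter (filtermap h F)"
    unfolding cauchy_filter_metric_filtermap
  proof (intro allI impI)
    fix e :: real assume "e > 0"
    then obtain l where "\<forall>\<^sub>F x in F. norm (h x - l) < e / 2" using approx[of "e / 2"] by auto
    moreover have "dist (h x) (h y) < e" if "norm (h x - l) < e / 2" "norm (h y - l) < e / 2" for x y
      using dist_triangle_half_l[of "h x" l e "h y"] that by (simp only: dist_norm)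
    ultimately show "\<exists>P. eventually P F \<and> (\<forall>x y. P x \<and> P y \<longrightarrow> dist (h x) (h y) < e)" by blast
  qed
  then have "\<exists>c. filtermap h F \<le> nhds c"
    using cauchy_filter_complete_converges[of "filtermap h F" UNIV] F complete_UNIV
    by (simp add: filtermap_bot_iff)
  then show ?thesis by (simp add: filterlim_def)
qed

text \<open>For a fixed late \<open>y0\<close>, \<open>f x * b\<close> is close to
  \<open>f x * g x * f y0 * b\<close>, which is close to \<open>f y0 * b\<close>. So
  \<open>f y0 * b\<close> serves as approximate limit; the second neighbourhood \<open>Q\<close> is
  chosen after \<open>y0\<close>, since it depends on this element.\<close>

lemma convergent_of_inverse_pair:
  fixes f g :: "'x \<Rightarrow> 'a::{real_normed_algebra, banach}"
  assumes F: "F \<noteq> bot" and f: "\<forall>\<^sub>F x in F. norm (f x) \<le> 1"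
    and gf: "\<And>b. ((\<lambda>(x, y). g x * f y * b) \<longlongrightarrow> b) (F \<times>\<^sub>F F)"
    and fg: "\<And>b. ((\<lambda>(x, y). f x * g y * b) \<longlongrightarrow> b) (F \<times>\<^sub>F F)"
  shows "\<exists>l. ((\<lambda>x. f x * b) \<longlongrightarrow> l) F"
proof (rule convergent_filterI[OF F])
  fix \<epsilon> :: real assume "\<epsilon> > 0"
  then have e2: "\<epsilon> / 2 > 0" by simp
  have ev: "\<exists>Q. eventually Q F \<and> (\<forall>x y. Q x \<longrightarrow> Q y \<longrightarrow> norm (p x * q y * b - b) < \<epsilon> / 2)"
    if "((\<lambda>(x, y). p x * q y * b) \<longlongrightarrow> b) (F \<times>\<^sub>F F)" for p q :: "'x \<Rightarrow> 'a" and b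
    using tendstoD[OF that e2] unfolding eventually_prod_same by (auto simp: dist_norm)
  obtain P where P: "eventually P F" "\<And>x y. P x \<Longrightarrow> P y \<Longrightarrow> norm (g x * f y * b - b) < \<epsilon> / 2"
    using ev[OF gf[of b]] by blast
  obtain y0 where y0: "P y0" using eventually_happens'[OF F P(1)] by blast
  define b' where "b' = f y0 * b"
  obtain Q where Q: "eventually Q F" "\<And>x y. Q x \<Longrightarrow> Q y \<Longrightarrow> norm (f x * g y * b' - b') < \<epsilon> / 2"
    using ev[OF fg[of b']] by blast
  have "\<forall>\<^sub>F x in F. norm (f x * b - b') < \<epsilon>"
    using f P(1) Q(1)
  proof eventually_elim
    case (elim x)
    have "f x * b - b' = - (f x * (g x * f y0 * b - b)) + (f x * g x * b' - b')"
      by (simp add: b'_def algebra_simps)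
    then have "norm (f x * b - b') \<le> norm (f x * (g x * f y0 * b - b)) + norm (f x * g x * b' - b')"
      by (metis norm_minus_cancel norm_triangle_ineq)
    also have "norm (f x * (g x * f y0 * b - b)) \<le> 1 * norm (g x * f y0 * b - b)"
      by (rule order_trans[OF norm_mult_ineq]) (intro mult_right_mono elim norm_ge_zero)
    finally show ?case using P(2)[OF elim(2) y0] Q(2)[OF elim(3,3)] by simp
  qed
  then show "\<exists>l. \<forall>\<^sub>F x in F. norm (f x * b - l) < \<epsilon>" by blast
qed

text \<open>Since \<open>f\<close> is contractive, \<open>g y * b\<close> may be replaced by its
  limit inside the joint limit. This makes the two strict limit maps below inverse to each
  other.\<close>

lemma iterated_limit_eq:
  fixes f g :: "'x \<Rightarrow> 'a::real_normed_algebra"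
  assumes F: "F \<noteq> bot" and f: "\<forall>\<^sub>F x in F. norm (f x) \<le> 1"
    and g: "((\<lambda>x. g x * b) \<longlongrightarrow> r) F" and fr: "((\<lambda>x. f x * r) \<longlongrightarrow> s) F"
    and fg: "((\<lambda>(x, y). f x * g y * b) \<longlongrightarrow> t) (F \<times>\<^sub>F F)"
  shows "s = t"
proof -
  let ?F = "F \<times>\<^sub>F F"
  have neq: "?F \<noteq> bot" using F by (simp add: prod_filter_eq_bot)
  have "((\<lambda>p. f (fst p) * (g (snd p) * b - r)) \<longlongrightarrow> 0) ?F"
    by (rule tendsto_contraction_mult(1)[OF eventually_compose_filterlim[OF f filterlim_fst]
          filterlim_compose[OF g filterlim_snd]])
  moreover have "((\<lambda>p. f (fst p) * g (snd p) * b) \<longlongrightarrow> t) ?F"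
    using fg by (simp add: case_prod_unfold)
  ultimately have "((\<lambda>p. f (fst p) * g (snd p) * b - f (fst p) * (g (snd p) * b - r)) \<longlongrightarrow> t - 0) ?F"
    by (intro tendsto_diff)
  then have "((\<lambda>p. f (fst p) * r) \<longlongrightarrow> t) ?F" by (simp add: algebra_simps)
  moreover have "((\<lambda>p. f (fst p) * r) \<longlongrightarrow> s) ?F"
    by (rule filterlim_compose[OF fr filterlim_fst])
  ultimately show ?thesis using tendsto_unique[OF neq] by blast
qed

section \<open>Weak* limits in the multiplier algebra\<close>

text \<open>Up to a uniformly small error \<open>f\<close> is \<open>dual_act f b\<close>, whose
  value at \<open>h x\<close> is \<open>f (b * h x)\<close>, and this converges. The limit is thus
  taken along \<open>F\<close> itself, without passing to a finer filter.\<close>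

lemma ex_bidual_limit:
  fixes h :: "'x \<Rightarrow> 'b::cstar_algebra"
  assumes F: "F \<noteq> bot" and h: "\<forall>\<^sub>F x in F. norm (h x) \<le> 1"
    and lim: "\<And>b. \<exists>l. ((\<lambda>x. b * h x) \<longlongrightarrow> l) F"
  shows "\<exists>u. \<forall>f. ((\<lambda>x. dual_apply f (h x)) \<longlongrightarrow> dual_apply u f) F"
proof -
  have "\<exists>l. ((\<lambda>x. dual_apply f (h x)) \<longlongrightarrow> l) F" for f
  proof (rule convergent_filterI[OF F])
    fix \<epsilon> :: real assume "\<epsilon> > 0"
    then have e2: "\<epsilon> / 2 > 0" by simp
    from dual_act_dense[OF e2, of f] obtain b where b: "norm (f - dual_act f b) \<le> \<epsilon> / 2" ..
    obtain m where "((\<lambda>x. b * h x) \<longlongrightarrow> m) F" using lim by blast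
    then have "((\<lambda>x. dual_apply f (b * h x)) \<longlongrightarrow> dual_apply f m) F"
      by (rule bounded_linear.tendsto[OF bounded_linear_dual_apply])
    from tendstoD[OF this e2]
    have "\<forall>\<^sub>F x in F. norm (dual_apply f (h x) - dual_apply f m) < \<epsilon>"
      using h
    proof eventually_elim
      case (elim x)
      have "norm (dual_apply f (h x) - dual_apply f (b * h x)) = norm (dual_apply (f - dual_act f b) (h x))"
        by (simp add: minus_cdual.rep_eq dual_act.rep_eq)
      also have "\<dots> \<le> norm (f - dual_act f b) * 1" using elim(2) by (rule norm_dual_apply_le)
      finally have "dist (dual_apply f (h x)) (dual_apply f (b * h x)) \<le> \<epsilon> / 2"
        using b by (simp add: dist_norm)
      with elim(1) have "dist (dual_apply f (h x)) (dual_apply f m) < \<epsilon>"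
        using dist_triangle[of "dual_apply f (h x)" "dual_apply f m" "dual_apply f (b * h x)"] by simp
      then show ?case by (simp add: dist_norm)
    qed
    then show "\<exists>l. \<forall>\<^sub>F x in F. norm (dual_apply f (h x) - l) < \<epsilon>" by blast
  qed
  then obtain U where U: "\<And>f. ((\<lambda>x. dual_apply f (h x)) \<longlongrightarrow> U f) F" by metis
  have "bounded_linear U \<and> complex_linear U"
  proof (rule dual_carrierI[of _ 1])
    fix f g :: "'b cdual" and c
    have "((\<lambda>x. dual_apply (f + g) (h x)) \<longlongrightarrow> U f + U g) F"
      unfolding plus_cdual.rep_eq by (intro tendsto_add U)
    then show "U (f + g) = U f + U g" using U tendsto_unique[OF F] by blast
    have "((\<lambda>x. dual_apply (c *\<^sub>C f) (h x)) \<longlongrightarrow> c * U f) F"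
      unfolding scaleC_cdual.rep_eq by (intro tendsto_mult_left U)
    then show "U (c *\<^sub>C f) = c * U f" using U tendsto_unique[OF F] by blast
    have "\<forall>\<^sub>F x in F. norm (dual_apply f (h x)) \<le> 1 * norm f"
      using h by eventually_elim (use norm_dual_apply_le[of _ 1 f] in \<open>simp\<close>)
    with tendsto_norm[OF U] show "norm (U f) \<le> 1 * norm f" by (rule tendsto_upperbound) (rule F)
  qed
  then have "dual_apply (CDual U) = U" by (simp add: CDual_inverse)
  with U show ?thesis by (intro exI[of _ "CDual U"]) simp
qed

text \<open>The Arens product is weak* continuous in its left factor, and in its right factor when
  the left one comes from the algebra; these are the two cases used.\<close>

lemma bidual_limit_mult:
  fixes h :: "'x \<Rightarrow> 'a::cstar_algebra"
  assumes F: "F \<noteq> bot" and u: "\<And>f. ((\<lambda>x. dual_apply f (h x)) \<longlongrightarrow> dual_apply u f) F"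
  shows "((\<lambda>x. h x * b) \<longlongrightarrow> l) F \<Longrightarrow> u \<box> bidual_embed b = bidual_embed l"
    and "((\<lambda>x. b * h x) \<longlongrightarrow> l) F \<Longrightarrow> bidual_embed b \<box> u = bidual_embed l"
proof -
  assume l: "((\<lambda>x. h x * b) \<longlongrightarrow> l) F"
  show "u \<box> bidual_embed b = bidual_embed l"
  proof (rule dual_eqI)
    fix f :: "'a cdual"
    have "((\<lambda>x. dual_apply f (h x * b)) \<longlongrightarrow> dual_apply f l) F"
      by (rule bounded_linear.tendsto[OF bounded_linear_dual_apply l])
    moreover have "((\<lambda>x. dual_apply f (h x * b)) \<longlongrightarrow> dual_apply u (bidual_act (bidual_embed b) f)) F"
      using u[of "bidual_act (bidual_embed b) f"]
      by (simp add: bidual_act.rep_eq bidual_embed.rep_eq dual_act.rep_eq)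
    ultimately show "dual_apply (u \<box> bidual_embed b) f = dual_apply (bidual_embed l) f"
      using tendsto_unique[OF F] by (simp add: bidual_mult.rep_eq bidual_embed.rep_eq)
  qed
next
  assume l: "((\<lambda>x. b * h x) \<longlongrightarrow> l) F"
  show "bidual_embed b \<box> u = bidual_embed l"
  proof (rule dual_eqI)
    fix f :: "'a cdual"
    have "((\<lambda>x. dual_apply f (b * h x)) \<longlongrightarrow> dual_apply f l) F"
      by (rule bounded_linear.tendsto[OF bounded_linear_dual_apply l])
    moreover have "((\<lambda>x. dual_apply f (b * h x)) \<longlongrightarrow> dual_apply u (dual_act f b)) F"
      using u[of "dual_act f b"] by (simp add: dual_act.rep_eq)
    ultimately show "dual_apply (bidual_embed b \<box> u) f = dual_apply (bidual_embed l) f"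
      using tendsto_unique[OF F]
      by (simp add: bidual_mult.rep_eq bidual_embed.rep_eq bidual_act.rep_eq)
  qed
qed

text \<open>Nondegeneracy reduces the unit laws to products with \<open>bidual_embed b\<close>, and
  the multiplier property moves those products back into the algebra.\<close>

lemma is_multiplier_unitI:
  fixes e :: "'a::cstar_algebra bidual"
  assumes "\<And>b. e \<box> bidual_embed b = bidual_embed b" "\<And>b. bidual_embed b \<box> e = bidual_embed b"
  shows "is_multiplier_unit e"
  unfolding is_multiplier_unit_def
proof (intro conjI ballI)
  show "e \<in> multiplier_algebra" by (simp add: multiplier_algebra_def assms)
  fix x :: "'a bidual" assume x: "x \<in> multiplier_algebra"
  show "e \<box> x = x"
    by (rule bidual_nondegenerate) (simp add: assms(2) flip: bidual_mult_assoc)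
  show "x \<box> e = x"
  proof (rule bidual_nondegenerate)
    fix b
    obtain c where "bidual_embed b \<box> x = bidual_embed c"
      using x by (auto simp: multiplier_algebra_def)
    then show "bidual_embed b \<box> (x \<box> e) = bidual_embed b \<box> x"
      by (simp add: assms(2) flip: bidual_mult_assoc)
  qed
qed

lemma bidual_star_limit:
  assumes u: "\<And>f. ((\<lambda>x. dual_apply f (h x)) \<longlongrightarrow> dual_apply u f) F"
  shows "((\<lambda>x. dual_apply f (star (h x))) \<longlongrightarrow> dual_apply (bidual_star u) f) F"
  using tendsto_cnj[OF u[of "dual_star f"]] by (simp add: bidual_star.rep_eq dual_star.rep_eq)


section \<open>Surjective isometries\<close>

theorem theorem1p3:
  fixes T :: "'a::cstar_algebra \<Rightarrow> 'b::cstar_algebra"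
  assumes "complex_linear T"
    and "\<forall>x. norm (T x) = norm x"
    and "surj T"
  shows "\<exists>(J :: 'a \<Rightarrow> 'b) (u :: 'b bidual).
           jordan_star_isomorphism J \<and> multiplier_unitary u \<and>
           (\<forall>x. bidual_embed (T x) = u \<box> bidual_embed (J x))"
proof -
  note lin = assms(1)
  have iso: "norm (T x) = norm x" for x using assms(2) by blast
  have T_add: "T (x + y) = T x + T y" and T_scaleC: "T (c *\<^sub>C x) = c *\<^sub>C T x" for c x y
    using lin by (auto simp: complex_linear_def)
  have T_diff: "T (x - y) = T x - T y" for x y by (rule complex_linear_diff[OF lin])
  have "bounded_linear T"
    by (rule bounded_linear_intro[of _ 1]) (auto simp: T_add complex_linear_scaleR[OF lin] iso)
  note T_lim = bounded_linear.tendsto[OF this]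
  have inj: "inj T"
  proof (rule injI)
    fix x y assume "T x = T y"
    then have "norm (x - y) = 0" using iso[of "x - y"] by (simp add: T_diff)
    then show "x = y" by simp
  qed
  \<comment> \<open>Polarization in the two outer variables.\<close>
  have triple: "T (x * star a * y + y * star a * x) = T x * star (T a) * T y + T y * star (T a) * T x"
    for x a y
  proof -
    note t = isometry_triple_product[OF lin iso assms(3)]
    have "x * star a * y + y * star a * x
        = (x + y) * star a * (x + y) - x * star a * x - y * star a * y"
      by (simp add: algebra_simps)
    then have "T (x * star a * y + y * star a * x)
        = (T x + T y) * star (T a) * (T x + T y) - T x * star (T a) * T x - T y * star (T a) * T y"
      by (simp only: T_diff t T_add)
    then show ?thesis by (simp add: algebra_simps)
  qed

  define F where "F = (approximate_units :: 'a filter)"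
  have F: "F \<noteq> bot" unfolding F_def by (rule approximate_units_neq_bot)
  have ev_pos: "\<forall>\<^sub>F e in F. positive_contraction e"
    unfolding F_def by (rule eventually_positive_contraction)
  have ev_star: "\<forall>\<^sub>F e in F. star e = e" and ev_1: "\<forall>\<^sub>F e in F. norm e \<le> 1"
    using ev_pos by (auto elim!: eventually_mono simp: positive_contraction_star positive_contraction_norm)
  have unit_r: "((\<lambda>e. x * e) \<longlongrightarrow> x) F" and unit_l: "((\<lambda>e. e * x) \<longlongrightarrow> x) F" for x
    unfolding F_def by (rule tendsto_mult_approximate_units)+
  let ?FF = "F \<times>\<^sub>F F"
  note fst = filterlim_fst[of F F] and snd = filterlim_snd[of F F]
  have ev_T: "\<forall>\<^sub>F e in F. norm (T e) \<le> 1" using ev_1 by (simp add: iso)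
  have ev_star_T: "\<forall>\<^sub>F e in F. norm (star (T e)) \<le> 1" using ev_T by (simp add: norm_star)

  \<comment> \<open>Double limits over two independent approximate units\<close>
  have sym: "((\<lambda>p. T (fst p) * star (T (snd p)) * b + b * star (T (snd p)) * T (fst p))
      \<longlongrightarrow> 2 *\<^sub>R b) ?FF" for b
  proof -
    obtain y where y: "b = T y" using assms(3) by (metis surj_def)
    note ev_fst = eventually_compose_filterlim[OF ev_1 fst]
    \<comment> \<open>The outer factor \<open>fst p\<close> is only bounded, so the inner error is
      split off before taking limits.\<close>
    have "((\<lambda>p. fst p * (snd p * y - y) + fst p * y
        + ((y * snd p - y) * fst p + y * fst p)) \<longlongrightarrow> 0 + y + (0 + y)) ?FF"
      by (intro tendsto_add tendsto_contraction_mult[OF ev_fst]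
          filterlim_compose[OF unit_l snd] filterlim_compose[OF unit_r snd]
          filterlim_compose[OF unit_l fst] filterlim_compose[OF unit_r fst])
    then have "((\<lambda>p. fst p * snd p * y + y * snd p * fst p) \<longlongrightarrow> y + y) ?FF"
      by (simp add: algebra_simps)
    from T_lim[OF this]
    have lim: "((\<lambda>p. T (fst p * snd p * y + y * snd p * fst p)) \<longlongrightarrow> 2 *\<^sub>R b) ?FF"
      by (simp add: T_add y scaleR_2)
    have "\<forall>\<^sub>F p in ?FF. T (fst p * snd p * y + y * snd p * fst p)
        = T (fst p) * star (T (snd p)) * b + b * star (T (snd p)) * T (fst p)"
      using eventually_compose_filterlim[OF ev_star snd]
    proof eventually_elim
      case (elim p)
      show ?case using triple[of "fst p" "snd p" y] by (simp add: elim y)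
    qed
    with lim show ?thesis by (rule Lim_transform_eventually)
  qed
  have swap: "filterlim (\<lambda>p. (snd p, fst p)) ?FF ?FF" by (rule filterlim_Pair[OF snd fst])
  let ?k = "\<lambda>p. T (fst p) * star (T (snd p))" and ?l = "\<lambda>p. star (T (snd p)) * T (fst p)"
  have contr: "norm (x * y) \<le> 1" if "norm x \<le> 1" "norm y \<le> 1" for x y :: 'b
    using norm_mult_ineq[of x y] mult_le_one[OF that(1) norm_ge_zero that(2)] by linarith
  have bd: "\<forall>\<^sub>F p in ?FF. norm (?k p) \<le> 1" "\<forall>\<^sub>F p in ?FF. norm (?l p) \<le> 1"
    using eventually_compose_filterlim[OF ev_T fst] eventually_compose_filterlim[OF ev_star_T snd]
    by (eventually_elim, simp add: contr)+
  have E1: "((\<lambda>p. ?k p * b + b * ?l p) \<longlongrightarrow> 2 *\<^sub>R b) ?FF" for b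
    using sym[of b] by (simp add: mult.assoc)
  \<comment> \<open>The adjoint of \<open>sym\<close> at \<open>star b\<close>, with the two indices
    exchanged.\<close>
  have E2: "((\<lambda>p. b * ?k p + ?l p * b) \<longlongrightarrow> 2 *\<^sub>R b) ?FF" for b
    using tendsto_star[OF filterlim_compose[OF sym[of "star b"] swap]]
    by (simp add: star_add star_mult star_star star_scaleR mult.assoc)
  have lim_k: "((\<lambda>p. ?k p * b) \<longlongrightarrow> b) ?FF" for b
    by (rule tendsto_mult_of_symmetrized[OF bd E1 E2])
  have lim_l: "((\<lambda>p. ?l p * b) \<longlongrightarrow> b) ?FF" for b
    by (rule tendsto_mult_of_symmetrized[OF bd(2,1)]) (use E1 E2 in \<open>simp_all add: add.commute\<close>)
  have TsT: "((\<lambda>(x, y). T x * star (T y) * b) \<longlongrightarrow> b) ?FF" for b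
    using lim_k[of b] by (simp add: case_prod_unfold)
  have sTT: "((\<lambda>(x, y). star (T x) * T y * b) \<longlongrightarrow> b) ?FF" for b
    using filterlim_compose[OF lim_l[of b] swap] by (simp add: case_prod_unfold)

  \<comment> \<open>Strict limits: \<open>L\<close> is left multiplication by the future
    \<open>u\<close>, \<open>R\<close> by its adjoint\<close>
  have "\<exists>l. ((\<lambda>e. star (T e) * b) \<longlongrightarrow> l) F" for b
    by (rule convergent_of_inverse_pair[OF F ev_star_T TsT sTT])
  then obtain R where R: "\<And>b. ((\<lambda>e. star (T e) * b) \<longlongrightarrow> R b) F" by metis
  have "\<exists>l. ((\<lambda>e. T e * b) \<longlongrightarrow> l) F" for b
    by (rule convergent_of_inverse_pair[OF F ev_T sTT TsT])
  then obtain L where L: "\<And>b. ((\<lambda>e. T e * b) \<longlongrightarrow> L b) F" by metis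
  have LR: "L (R b) = b" for b by (rule iterated_limit_eq[OF F ev_T R L TsT])
  have RL: "R (L b) = b" for b by (rule iterated_limit_eq[OF F ev_star_T L R sTT])
  have L': "((\<lambda>e. b * star (T e)) \<longlongrightarrow> star (L (star b))) F" for b
    using tendsto_star[OF L[of "star b"]] by (simp add: star_mult star_star)
  have R': "((\<lambda>e. b * T e) \<longlongrightarrow> star (R (star b))) F" for b
    using tendsto_star[OF R[of "star b"]] by (simp add: star_mult star_star)
  note unique = tendsto_unique[OF F]
  have R_add: "R (b + c) = R b + R c" for b c
  proof (rule unique[OF R])
    show "((\<lambda>e. star (T e) * (b + c)) \<longlongrightarrow> R b + R c) F"
      unfolding distrib_left by (intro tendsto_add R)
  qed
  have R_scaleC: "R (d *\<^sub>C b) = d *\<^sub>C R b" for d b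
  proof (rule unique[OF R])
    show "((\<lambda>e. star (T e) * d *\<^sub>C b) \<longlongrightarrow> d *\<^sub>C R b) F"
      unfolding scaleC_mult_right by (intro tendsto_scaleC R)
  qed
  have R_mult: "R (b * c) = R b * c" for b c
  proof (rule unique[OF R])
    show "((\<lambda>e. star (T e) * (b * c)) \<longlongrightarrow> R b * c) F"
      unfolding mult.assoc[symmetric] by (intro tendsto_mult_right R)
  qed

  \<comment> \<open>The Jordan isomorphism\<close>
  define J where "J = (\<lambda>x. R (T x))"
  have J_star: "J (star x) = star (J x)" for x
  proof -
    have "((\<lambda>e. e * (star x * e - star x) + e * star x) \<longlongrightarrow> 0 + star x) F"
      by (intro tendsto_add tendsto_contraction_mult[OF ev_1] unit_l unit_r)
    then have "((\<lambda>e. e * star x * e) \<longlongrightarrow> star x) F" by (simp add: algebra_simps)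
    from T_lim[OF this] have 1: "((\<lambda>e. T e * star (T x) * T e) \<longlongrightarrow> T (star x)) F"
      by (simp add: isometry_triple_product[OF lin iso assms(3)])
    \<comment> \<open>The image of \<open>e * star x * e\<close> is evaluated from the inside:
      \<open>star (T x) * T e\<close> tends to \<open>star (J x)\<close>, and the outer
      \<open>T e\<close> then acts as \<open>L\<close>.\<close>
    have "((\<lambda>e. T e * (star (T x) * T e - star (J x)) + T e * star (J x)) \<longlongrightarrow> 0 + L (star (J x))) F"
      by (intro tendsto_add tendsto_contraction_mult[OF ev_T] L)
        (use R'[of "star (T x)"] in \<open>simp add: J_def star_star\<close>)
    then have "((\<lambda>e. T e * star (T x) * T e) \<longlongrightarrow> L (star (J x))) F" by (simp add: algebra_simps)
    with 1 have "T (star x) = L (star (J x))" by (rule unique)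
    then show ?thesis using RL by (simp add: J_def)
  qed
  have J_anticommutator: "J (x * y + y * x) = J x * J y + J y * J x" for x y
  proof -
    have "((\<lambda>e. (x * e) * y + (y * e) * x) \<longlongrightarrow> x * y + y * x) F"
      by (intro tendsto_add tendsto_mult_right unit_r)
    from T_lim[OF this] have 1: "((\<lambda>e. T (x * e * y + y * e * x)) \<longlongrightarrow> T (x * y + y * x)) F" .
    have "\<forall>\<^sub>F e in F. T (x * e * y + y * e * x) = T x * star (T e) * T y + T y * star (T e) * T x"
      using ev_star
    proof eventually_elim
      case (elim e)
      show ?case using triple[of x e y] by (simp add: elim)
    qed
    with 1 have 2: "((\<lambda>e. T x * star (T e) * T y + T y * star (T e) * T x) \<longlongrightarrow> T (x * y + y * x)) F"
      by (rule Lim_transform_eventually)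
    \<comment> \<open>The middle factor \<open>star (T e)\<close> turns \<open>T y\<close> into
      \<open>J y\<close>; applying \<open>R\<close>, which commutes with right multiplication, then
      turns the outer \<open>T x\<close> into \<open>J x\<close>.\<close>
    have "((\<lambda>e. T x * (star (T e) * T y) + T y * (star (T e) * T x)) \<longlongrightarrow> T x * J y + T y * J x) F"
      unfolding J_def by (intro tendsto_add tendsto_mult_left R)
    with 2 have "T (x * y + y * x) = T x * J y + T y * J x"
      by (intro unique) (simp_all add: mult.assoc)
    then show ?thesis by (simp add: J_def R_add R_mult)
  qed
  have "bij R" by (rule o_bij[of L]) (auto simp: fun_eq_iff LR RL)
  moreover have "bij T" using inj assms(3) by (rule bijI)
  ultimately have "bij J" using bij_comp[of T R] by (simp add: J_def comp_def)
  moreover have "complex_linear J"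
    by (simp add: complex_linear_def J_def T_add T_scaleC R_add R_scaleC)
  moreover have "J (jordan_product x y) = jordan_product (J x) (J y)" for x y
    using J_anticommutator[of x y] by (simp add: jordan_product_def J_def T_scaleC R_scaleC)
  ultimately have "jordan_star_isomorphism J"
    by (simp add: jordan_star_isomorphism_def J_star)

  \<comment> \<open>The unitary as a weak* limit of \<open>T e\<close>\<close>
  moreover
  have "\<exists>l. ((\<lambda>e. b * T e) \<longlongrightarrow> l) F" for b using R' by blast
  then obtain u where u: "\<And>f. ((\<lambda>e. dual_apply f (T e)) \<longlongrightarrow> dual_apply u f) F"
    using ex_bidual_limit[OF F ev_T] by blast
  note u_star = bidual_star_limit[OF u]
  note u_mult = bidual_limit_mult[OF F u] and u_star_mult = bidual_limit_mult[OF F u_star]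
  have "multiplier_unitary u"
    unfolding multiplier_unitary_def
  proof (intro conjI)
    show "u \<in> multiplier_algebra"
      using u_mult(1)[OF L] u_mult(2)[OF R'] by (auto simp: multiplier_algebra_def)
    show "is_multiplier_unit (bidual_star u \<box> u)"
    proof (rule is_multiplier_unitI)
      fix b
      show "bidual_star u \<box> u \<box> bidual_embed b = bidual_embed b"
        by (simp add: bidual_mult_assoc u_mult(1)[OF L] u_star_mult(1)[OF R] RL)
      show "bidual_embed b \<box> (bidual_star u \<box> u) = bidual_embed b"
        by (simp add: u_star_mult(2)[OF L'] u_mult(2)[OF R'] RL star_star flip: bidual_mult_assoc)
    qed
    show "is_multiplier_unit (u \<box> bidual_star u)"
    proof (rule is_multiplier_unitI)
      fix b
      show "u \<box> bidual_star u \<box> bidual_embed b = bidual_embed b"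
        by (simp add: bidual_mult_assoc u_mult(1)[OF L] u_star_mult(1)[OF R] LR)
      show "bidual_embed b \<box> (u \<box> bidual_star u) = bidual_embed b"
        by (simp add: u_star_mult(2)[OF L'] u_mult(2)[OF R'] LR star_star flip: bidual_mult_assoc)
    qed
  qed
  moreover have "bidual_embed (T x) = u \<box> bidual_embed (J x)" for x
    by (simp add: u_mult(1)[OF L] J_def LR)
  ultimately show ?thesis by blast
qed

end
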